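(* Let $m\ge2$ and $k\in\{1,\dots,m-1\}$ be integers. Let $\varphi\in C^\infty(Y)$ be a $\hat g$-admissible and $G$-invariant function with $\sup_Y\varphi=0$. Then $\varphi\ge\hat\psi$ on $Y$.
   Context: $Y$ is the blow-up of $\mathbb{P}_m\mathbb{C}$ along $\{[z_0,\dots,z_k,0,\dots,0]\}\cong\mathbb{P}_k\mathbb{C}$ and $\{[0,\dots,0,z_{k+1},\dots,z_m]\}\cong\mathbb{P}_{m-k-1}\mathbb{C}$, realised as the submanifold of $\mathbb{P}_m\mathbb{C}\times\mathbb{P}_k\mathbb{C}\times\mathbb{P}_{m-k-1}\mathbb{C}$ of points $([z_0,\dots,z_m],[\zeta_0,\dots,\zeta_k],[\eta_{k+1},\dots,\eta_m])$ such that $(z_0,\dots,z_k)$ is proportional to $(\zeta_0,\dots,\zeta_k)$ and $(z_{k+1},\dots,z_m)$ is proportional to $(\eta_{k+1},\dots,\eta_m)$. Let $\pi_1,\pi_2,\pi_3$ be the projections of $Y$ to the three factors. Write $\partial_{\lambda\bar\mu}=\frac{\partial^2}{\partial z_\lambda\partial\bar z_\mu}$. Metric: $\hat g=2\pi_1^*g_m+k\,\pi_2^*g_k+(m-k-1)\pi_3^*g_{m-k-1}$, where $g_n$ is the Fubini–Study metric of $\mathbb{P}_n\mathbb{C}$ with components $\partial_{\lambda\bar\mu}\ln(1+|z_1|^2+\dots+|z_n|^2)$ in the chart $z_0=1$. Thus in the dense chart of points $([1,z_1,\dots,z_m],[1,z_1,\dots,z_k],[z_{k+1},\dots,z_m])$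 with $(z_{k+1},\dots,z_m)\ne0$, $\hat g_{\lambda\bar\mu}=2\partial_{\lambda\bar\mu}\ln(1+|z_1|^2+\dots+|z_m|^2)+k\,\partial_{\lambda\bar\mu}\ln(1+|z_1|^2+\dots+|z_k|^2)+(m-k-1)\partial_{\lambda\bar\mu}\ln(|z_{k+1}|^2+\dots+|z_m|^2)$. A real function $\varphi\in C^\infty(Y)$ is $\hat g$-admissible if the Hermitian matrix $(\hat g_{\lambda\bar\mu}+\partial_{\lambda\bar\mu}\varphi)$ is positive definite at every point of $Y$ (in local holomorphic coordinates). Group: $G$ is the group of automorphisms of $Y$ naturally induced by the automorphisms of $\mathbb{P}_m\mathbb{C}$ exchanging $z_i$ and $z_j$ ($i,j\in\{0,\dots,k\}$), exchanging $z_p$ and $z_q$ ($p,q\in\{k+1,\dots,m\}$), and replacing $z_l$ by $z_le^{i\theta}$ ($l\in\{0,\dots,m\}$, $\theta\in[0,2\pi]$); on $Y$ the coordinates $\zeta_0,\dots,\zeta_k$ and $\eta_{k+1},\dots,\eta_m$ are transformed in the same way as $z_0,\dots,z_k$ and $z_{k+1},\dots,z_m$ respectively. The function $\hat\psi=\inf(\hat\psi_1,\hat\psi_2)$, where at the point $([z_0,\dots,z_m],[\zeta_0,\dots,\zeta_k],[\eta_{k+1},\dots,\eta_m])\in Y$ $$\hat\psi_1=\ln\left\{\frac{(|z_0|\cdots|z_k|)^{\frac{4}{k+1}}}{(|z_0|^2+\dots+|z_m|^2)^2}\cdot\frac{(|\zeta_0|\cdots|\zeta_k|)^{\frac{2k}{k+1}}}{(|\zeta_0|^2+\dots+|\zeta_k|^2)^k}\cdot\frac{(|\eta_{k+1}|\cdots|\eta_m|)^{\frac{2(m-k-1)}{m-k}}}{(|\eta_{k+1}|^2+\dots+|\eta_m|^2)^{m-k-1}}\right\},$$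 $$\hat\psi_2=\ln\left\{\frac{(|z_{k+1}|\cdots|z_m|)^{\frac{4}{m-k}}}{(|z_0|^2+\dots+|z_m|^2)^2}\cdot\frac{(|\zeta_0|\cdots|\zeta_k|)^{\frac{2k}{k+1}}}{(|\zeta_0|^2+\dots+|\zeta_k|^2)^k}\cdot\frac{(|\eta_{k+1}|\cdots|\eta_m|)^{\frac{2(m-k-1)}{m-k}}}{(|\eta_{k+1}|^2+\dots+|\eta_m|^2)^{m-k-1}}\right\}.$$ These are finite where no coordinate vanishes; with the convention $\ln0=-\infty$, $\hat\psi=-\infty$ where some coordinate vanishes. *)

theory Defs
  imports "HOL-Analysis.Analysis"
begin

(* Index types: 'a stands for {0..k}, 'b for {k+1..m}, hence 'a + 'b for {0..m}.
   The integers k and m enter through CARD('a) = k + 1 and CARD('b) = m - k. *)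

definition pt :: "complex ^ 'n \<Rightarrow> (complex ^ 'n) set"  \<comment> \<open>the point [z], as the complex line spanned by z\<close>
  where "pt z = range (\<lambda>c. c *s z)"

definition fst_block :: "complex ^ ('a::finite + 'b::finite) \<Rightarrow> complex ^ 'a"
  where "fst_block z = (\<chi> i. z $ Inl i)"

definition snd_block :: "complex ^ ('a::finite + 'b::finite) \<Rightarrow> complex ^ 'b"
  where "snd_block z = (\<chi> j. z $ Inr j)"

(* A block of z may vanish; "proportional" therefore means: a multiple, possibly zero, of the
   nonzero vector zeta (respectively eta). *)
definition Y_coords :: "complex ^ ('a::finite + 'b::finite) \<Rightarrow> complex ^ 'a \<Rightarrow> complex ^ 'b \<Rightarrow> bool"
  where "Y_coords z \<zeta> \<eta> \<longleftrightarrow> z \<noteq> 0 \<and> \<zeta> \<noteq> 0 \<and> \<eta> \<noteq> 0 \<and>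
           (\<exists>s. fst_block z = s *s \<zeta>) \<and> (\<exists>t. snd_block z = t *s \<eta>)"

type_synonym ('a, 'b) triple =
  "(complex ^ ('a + 'b)) set \<times> (complex ^ 'a) set \<times> (complex ^ 'b) set"

definition Y :: "('a::finite, 'b::finite) triple set"
  where "Y = {(pt z, pt \<zeta>, pt \<eta>) | z \<zeta> \<eta>. Y_coords z \<zeta> \<eta>}"

(* The affine chart z_p = 1 of projective space is parametrised by complex ^ 'n with the slot p
   ignored, so that its coordinates are indexed by UNIV - {p}. *)
definition aff :: "'n \<Rightarrow> complex ^ 'n \<Rightarrow> complex ^ 'n"
  where "aff p x = (\<chi> l. if l = p then 1 else x $ l)"

(* Charts of Y, for i :: 'a, j :: 'b and p = Inl i or p = Inr j: the image is the open set
   where z_p, zeta_i, eta_j are all nonzero, normalised by z_p = zeta_i = eta_j = 1.  There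
   fst_block z = z_i zeta and snd_block z = z_j eta, so that zeta_l (l ~= i), eta_q (q ~= j) and
   the one of z_i, z_j that is not normalised form m holomorphic coordinates, with slot p ignored. *)
definition zeta_lift :: "'a \<Rightarrow> complex ^ ('a::finite + 'b::finite) \<Rightarrow> complex ^ 'a"
  where "zeta_lift i x = aff i (fst_block x)"

definition eta_lift :: "'b \<Rightarrow> complex ^ ('a::finite + 'b::finite) \<Rightarrow> complex ^ 'b"
  where "eta_lift j x = aff j (snd_block x)"

definition z_lift :: "'a + 'b \<Rightarrow> 'a \<Rightarrow> 'b \<Rightarrow> complex ^ ('a::finite + 'b::finite) \<Rightarrow> complex ^ ('a + 'b)"
  where "z_lift p i j x =
    (\<chi> n. case n of Inl l \<Rightarrow> aff p x $ Inl i * zeta_lift i x $ l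
                  | Inr q \<Rightarrow> aff p x $ Inr j * eta_lift j x $ q)"

definition chart :: "'a + 'b \<Rightarrow> 'a \<Rightarrow> 'b \<Rightarrow> complex ^ ('a::finite + 'b::finite) \<Rightarrow> ('a, 'b) triple"
  where "chart p i j x = (pt (z_lift p i j x), pt (zeta_lift i x), pt (eta_lift j x))"

definition atlas :: "(('a::finite + 'b::finite) \<times> 'a \<times> 'b) set"
  where "atlas = {(p, i, j). p = Inl i \<or> p = Inr j}"

primrec Ck :: "nat \<Rightarrow> ('v::euclidean_space \<Rightarrow> real) \<Rightarrow> bool" where
  "Ck 0 f \<longleftrightarrow> continuous_on UNIV f"
| "Ck (Suc n) f \<longleftrightarrow> (\<forall>x. f differentiable (at x)) \<and>
                    (\<forall>v. Ck n (\<lambda>x. frechet_derivative f (at x) v))"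

definition smooth :: "('v::euclidean_space \<Rightarrow> real) \<Rightarrow> bool"
  where "smooth f \<longleftrightarrow> (\<forall>n. Ck n f)"

definition smooth_on_Y :: "(('a::finite, 'b::finite) triple \<Rightarrow> real) \<Rightarrow> bool"
  where "smooth_on_Y \<phi> \<longleftrightarrow> (\<forall>(p, i, j)\<in>atlas. smooth (\<lambda>x. \<phi> (chart p i j x)))"

definition d_z :: "'n::finite \<Rightarrow> (complex ^ 'n \<Rightarrow> complex) \<Rightarrow> complex ^ 'n \<Rightarrow> complex"
  where "d_z l f x = (frechet_derivative f (at x) (axis l 1)
                      - \<i> * frechet_derivative f (at x) (axis l \<i>)) / 2"

definition d_zbar :: "'n::finite \<Rightarrow> (complex ^ 'n \<Rightarrow> complex) \<Rightarrow> complex ^ 'n \<Rightarrow> complex"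
  where "d_zbar l f x = (frechet_derivative f (at x) (axis l 1)
                         + \<i> * frechet_derivative f (at x) (axis l \<i>)) / 2"

definition ddbar :: "(complex ^ 'n::finite \<Rightarrow> real) \<Rightarrow> complex ^ 'n \<Rightarrow> 'n \<Rightarrow> 'n \<Rightarrow> complex"
  where "ddbar f x \<kappa> \<mu> = d_z \<kappa> (d_zbar \<mu> (\<lambda>y. complex_of_real (f y))) x"

(* Components of the Fubini-Study metric in the chart z_p = 1; by invariance under permutations
   of the homogeneous coordinates they have the same form for every p.  They vanish when an index
   equals p, the potential being independent of the ignored slot. *)
definition fubini_study :: "'n::finite \<Rightarrow> complex ^ 'n \<Rightarrow> 'n \<Rightarrow> 'n \<Rightarrow> complex"
  where "fubini_study p = ddbar (\<lambda>x. ln (1 + (\<Sum>l\<in>UNIV - {p}. (cmod (x $ l))\<^sup>2)))"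

definition pullback ::
  "(complex ^ 'd::finite \<Rightarrow> complex ^ 'n::finite) \<Rightarrow> (complex ^ 'n \<Rightarrow> 'n \<Rightarrow> 'n \<Rightarrow> complex)
    \<Rightarrow> complex ^ 'd \<Rightarrow> 'd \<Rightarrow> 'd \<Rightarrow> complex"  \<comment> \<open>of a Hermitian metric under a holomorphic map\<close>
  where "pullback F g x \<kappa> \<mu> =
    (\<Sum>\<alpha>\<in>UNIV. \<Sum>\<beta>\<in>UNIV. g (F x) \<alpha> \<beta> * d_z \<kappa> (\<lambda>y. F y $ \<alpha>) x * cnj (d_z \<mu> (\<lambda>y. F y $ \<beta>) x))"

(* In chart p i j the projections of Y to the three factors are z_lift, zeta_lift and eta_lift,
   with values in the affine charts z_p = 1, zeta_i = 1 and eta_j = 1. *)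
definition g_hat :: "nat \<Rightarrow> nat \<Rightarrow> 'a::finite + 'b::finite \<Rightarrow> 'a \<Rightarrow> 'b
    \<Rightarrow> complex ^ ('a + 'b) \<Rightarrow> 'a + 'b \<Rightarrow> 'a + 'b \<Rightarrow> complex"
  where "g_hat m k p i j x \<kappa> \<mu> =
      2 * pullback (z_lift p i j) (fubini_study p) x \<kappa> \<mu>
    + of_nat k * pullback (zeta_lift i) (fubini_study i) x \<kappa> \<mu>
    + of_nat (m - k - 1) * pullback (eta_lift j) (fubini_study j) x \<kappa> \<mu>"

definition pos_def_on :: "'n set \<Rightarrow> ('n::finite \<Rightarrow> 'n \<Rightarrow> complex) \<Rightarrow> bool"
  where "pos_def_on S H \<longleftrightarrow>
    (\<forall>\<kappa>\<in>S. \<forall>\<mu>\<in>S. H \<mu> \<kappa> = cnj (H \<kappa> \<mu>)) \<and>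
    (\<forall>v :: 'n \<Rightarrow> complex. (\<exists>\<kappa>\<in>S. v \<kappa> \<noteq> 0) \<longrightarrow>
        0 < Re (\<Sum>\<kappa>\<in>S. \<Sum>\<mu>\<in>S. H \<kappa> \<mu> * v \<kappa> * cnj (v \<mu>)))"

definition admissible :: "nat \<Rightarrow> nat \<Rightarrow> (('a::finite, 'b::finite) triple \<Rightarrow> real) \<Rightarrow> bool"
  where "admissible m k \<phi> \<longleftrightarrow> (\<forall>(p, i, j)\<in>atlas. \<forall>x.
    pos_def_on (UNIV - {p})
      (\<lambda>\<kappa> \<mu>. g_hat m k p i j x \<kappa> \<mu> + ddbar (\<lambda>y. \<phi> (chart p i j y)) x \<kappa> \<mu>))"

definition exchange :: "'n \<Rightarrow> 'n \<Rightarrow> complex ^ 'n \<Rightarrow> complex ^ 'n"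
  where "exchange a b z = (\<chi> l. z $ Transposition.transpose a b l)"

definition rotate_coord :: "'n \<Rightarrow> real \<Rightarrow> complex ^ 'n \<Rightarrow> complex ^ 'n"
  where "rotate_coord a \<theta> z = (\<chi> l. if l = a then z $ l * exp (\<i> * complex_of_real \<theta>) else z $ l)"

(* A linear map acts on a projective point, i.e. on a line, by taking images.  The set of generators
   is closed under inversion on Y, so closing it under composition yields the generated group. *)
inductive_set G :: "(('a::finite, 'b::finite) triple \<Rightarrow> ('a, 'b) triple) set" where
  G_id: "id \<in> G"
| G_exchange_fst: "(\<lambda>(P, Q, R). (exchange (Inl i) (Inl i') ` P, exchange i i' ` Q, R)) \<in> G"
| G_exchange_snd: "(\<lambda>(P, Q, R). (exchange (Inr j) (Inr j') ` P, Q, exchange j j' ` R)) \<in> G"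
| G_rotate_fst: "\<theta> \<in> {0..2 * pi} \<Longrightarrow>
    (\<lambda>(P, Q, R). (rotate_coord (Inl i) \<theta> ` P, rotate_coord i \<theta> ` Q, R)) \<in> G"
| G_rotate_snd: "\<theta> \<in> {0..2 * pi} \<Longrightarrow>
    (\<lambda>(P, Q, R). (rotate_coord (Inr j) \<theta> ` P, Q, rotate_coord j \<theta> ` R)) \<in> G"
| G_comp: "g \<in> G \<Longrightarrow> h \<in> G \<Longrightarrow> g \<circ> h \<in> G"

definition G_invariant :: "(('a::finite, 'b::finite) triple \<Rightarrow> real) \<Rightarrow> bool"
  where "G_invariant \<phi> \<longleftrightarrow> (\<forall>g\<in>G. \<forall>y\<in>Y. \<phi> (g y) = \<phi> y)"

definition ln_ext :: "real \<Rightarrow> ereal"  \<comment> \<open>logarithm on nonnegative reals, with value -\<infinity> at 0\<close>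
  where "ln_ext x = (if x = 0 then -\<infinity> else ereal (ln x))"

definition abs_prod :: "complex ^ 'n \<Rightarrow> real"
  where "abs_prod z = (\<Prod>l\<in>UNIV. cmod (z $ l))"

definition sq_sum :: "complex ^ 'n \<Rightarrow> real"
  where "sq_sum z = (\<Sum>l\<in>UNIV. (cmod (z $ l))\<^sup>2)"

(* 0 powr 0 = 0 is harmless below: the only exponent that can vanish is the one of abs_prod eta,
   for m - k = 1, and then the single coordinate of eta is nonzero. *)
definition psi1 :: "nat \<Rightarrow> nat \<Rightarrow> complex ^ ('a::finite + 'b::finite) \<Rightarrow> complex ^ 'a \<Rightarrow> complex ^ 'b \<Rightarrow> ereal"
  where "psi1 m k z \<zeta> \<eta> = ln_ext (
      (abs_prod (fst_block z) powr (4 / (real k + 1)) / (sq_sum z) ^ 2)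
    * (abs_prod \<zeta> powr (2 * real k / (real k + 1)) / (sq_sum \<zeta>) ^ k)
    * (abs_prod \<eta> powr (2 * (real m - real k - 1) / (real m - real k)) / (sq_sum \<eta>) ^ (m - k - 1)))"

definition psi2 :: "nat \<Rightarrow> nat \<Rightarrow> complex ^ ('a::finite + 'b::finite) \<Rightarrow> complex ^ 'a \<Rightarrow> complex ^ 'b \<Rightarrow> ereal"
  where "psi2 m k z \<zeta> \<eta> = ln_ext (
      (abs_prod (snd_block z) powr (4 / (real m - real k)) / (sq_sum z) ^ 2)
    * (abs_prod \<zeta> powr (2 * real k / (real k + 1)) / (sq_sum \<zeta>) ^ k)
    * (abs_prod \<eta> powr (2 * (real m - real k - 1) / (real m - real k)) / (sq_sum \<eta>) ^ (m - k - 1)))"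

(* A function of homogeneous coordinates, of degree 0 separately in z, zeta and eta. *)
definition psi_hat :: "nat \<Rightarrow> nat \<Rightarrow> complex ^ ('a::finite + 'b::finite) \<Rightarrow> complex ^ 'a \<Rightarrow> complex ^ 'b \<Rightarrow> ereal"
  where "psi_hat m k z \<zeta> \<eta> = inf (psi1 m k z \<zeta> \<eta>) (psi2 m k z \<zeta> \<eta>)"

lemma pt_scale: "c \<noteq> 0 \<Longrightarrow> pt (c *s z) = pt z"
  unfolding pt_def
proof (intro equalityI subsetI)
  fix w assume c: "c \<noteq> 0" and "w \<in> range (\<lambda>d. d *s z)"
  then obtain d where "w = d *s z" by auto
  with c have "w = (d / c) *s (c *s z)" by simp
  then show "w \<in> range (\<lambda>d. d *s (c *s z))" by blast
qed auto

lemma Y_eq_charts: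
  "(Y :: ('a::finite, 'b::finite) triple set) = (\<Union>(p, i, j)\<in>atlas. range (chart p i j))"
proof (intro equalityI subsetI)
  fix y :: "('a, 'b) triple" assume "y \<in> (\<Union>(p, i, j)\<in>atlas. range (chart p i j))"
  then obtain p i j x where pij: "p = Inl i \<or> p = Inr j" and y: "y = chart p i j x"
    by (auto simp: atlas_def)
  have 1: "z_lift p i j x $ p = 1"
    using pij by (auto simp: z_lift_def zeta_lift_def eta_lift_def aff_def)
  have 2: "zeta_lift i x $ i = 1" "eta_lift j x $ j = 1"
    by (auto simp: zeta_lift_def eta_lift_def aff_def)
  have 3: "fst_block (z_lift p i j x) = (aff p x $ Inl i) *s zeta_lift i x"
          "snd_block (z_lift p i j x) = (aff p x $ Inr j) *s eta_lift j x"
    by (auto simp: fst_block_def snd_block_def z_lift_def vec_eq_iff)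
  have "z_lift p i j x \<noteq> 0" "zeta_lift i x \<noteq> 0" "eta_lift j x \<noteq> 0"
    using 1 2 by auto
  then have "Y_coords (z_lift p i j x) (zeta_lift i x) (eta_lift j x)"
    using 3 unfolding Y_coords_def by blast
  then show "y \<in> Y" unfolding y chart_def Y_def by blast
next
  fix y :: "('a, 'b) triple" assume "y \<in> Y"
  then obtain z \<zeta> \<eta> where y: "y = (pt z, pt \<zeta>, pt \<eta>)" and Yc: "Y_coords z \<zeta> \<eta>"
    by (auto simp: Y_def)
  from Yc obtain s t where nz: "z \<noteq> 0" "\<zeta> \<noteq> 0" "\<eta> \<noteq> 0"
    and s: "fst_block z = s *s \<zeta>" and t: "snd_block z = t *s \<eta>"
    by (auto simp: Y_coords_def)
  have zl: "z $ Inl l = s * \<zeta> $ l" for l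
    using s by (simp add: fst_block_def vec_eq_iff)
  have zr: "z $ Inr q = t * \<eta> $ q" for q
    using t by (simp add: snd_block_def vec_eq_iff)
  obtain p where p: "z $ p \<noteq> 0" using nz(1) by (auto simp: vec_eq_iff)
  obtain i0 where i0: "\<zeta> $ i0 \<noteq> 0" using nz(2) by (auto simp: vec_eq_iff)
  obtain j0 where j0: "\<eta> $ j0 \<noteq> 0" using nz(3) by (auto simp: vec_eq_iff)
  obtain i j where pij: "p = Inl i \<or> p = Inr j" and i: "\<zeta> $ i \<noteq> 0" and j: "\<eta> $ j \<noteq> 0"
  proof (cases p)
    case (Inl l)
    then have "\<zeta> $ l \<noteq> 0" using p zl by auto
    then show ?thesis using that[of l j0] Inl j0 by simp
  next
    case (Inr q)
    then have "\<eta> $ q \<noteq> 0" using p zr by auto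
    then show ?thesis using that[of i0 q] Inr i0 by simp
  qed
  define x :: "complex ^ ('a + 'b)" where
    "x = (\<chi> n. case n of Inl l \<Rightarrow> if l = i then z $ Inl i / z $ p else \<zeta> $ l / \<zeta> $ i
                       | Inr q \<Rightarrow> if q = j then z $ Inr j / z $ p else \<eta> $ q / \<eta> $ j)"
  have a: "zeta_lift i x = inverse (\<zeta> $ i) *s \<zeta>"
    using i by (auto simp: zeta_lift_def aff_def fst_block_def x_def vec_eq_iff field_simps)
  have b: "eta_lift j x = inverse (\<eta> $ j) *s \<eta>"
    using j by (auto simp: eta_lift_def aff_def snd_block_def x_def vec_eq_iff field_simps)
  have ai: "aff p x $ Inl i = z $ Inl i / z $ p"
    using p pij by (auto simp: aff_def x_def)
  have aj: "aff p x $ Inr j = z $ Inr j / z $ p"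
    using p pij by (auto simp: aff_def x_def)
  have c: "z_lift p i j x $ n = (inverse (z $ p) *s z) $ n" for n
    using i j p by (cases n) (simp_all add: z_lift_def a b ai aj zl zr field_simps)
  then have c: "z_lift p i j x = inverse (z $ p) *s z"
    by (simp add: vec_eq_iff)
  have "chart p i j x = y"
    using p i j by (simp add: chart_def a b c y pt_scale)
  then have "y \<in> range (chart p i j)" by (metis rangeI)
  moreover have "(p, i, j) \<in> atlas" using pij by (simp add: atlas_def)
  ultimately show "y \<in> (\<Union>(p, i, j)\<in>atlas. range (chart p i j))" by blast
qed

end

theory Submission
  imports Defs
begin

text \<open>
  On the dense torus of points of \<open>Y\<close> all of whose coordinates are nonzero, let \<open>u\<^sub>n = ln \<bar>z\<^sub>n\<bar>\<close>, let
  \<open>K u\<close> be the potential of the reference metric (\<open>ref_potential\<close>) and let \<open>F = K + \<phi>\<close>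
  (\<open>log_potential\<close>).  By invariance under rotations \<open>\<phi>\<close> is a function of \<open>u\<close>, and admissibility says that
  \<open>F\<close> is convex along every line (\<open>convex_on_log_potential\<close>): the second derivative of \<open>F\<close> along a line is
  four times the Levi form on the tangent vector of a holomorphic curve with exponential
  coordinates (\<open>levi_along_exp_curve\<close>).

  Let \<open>h w = 4 max w + 2 k max w' + 2 (m - k - 1) max w''\<close>, where \<open>w'\<close> and \<open>w''\<close> are the two blocks of
  \<open>w\<close>; it is the support function of the moment polytope, and \<open>h \<le> K\<close>.  Since \<open>\<phi> \<le> 0\<close>, \<open>F \<le> K\<close> grows
  at most like \<open>h\<close>, and convexity gives \<open>F (v + w) \<le> F v + h w\<close> for all \<open>v\<close> and \<open>w\<close>
  (\<open>log_potential_growth\<close>).  Since \<open>F\<close> is also symmetric in each block, replacing both blocks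
  of \<open>u\<close> by their means \<open>s\<close> and \<open>t\<close> gives a point \<open>v\<close> with \<open>F v \<le> F u\<close> (\<open>log_potential_ge_at_means\<close>).
  As \<open>sup \<phi> = 0\<close> and the torus is dense, for every \<open>e > 0\<close> some \<open>x\<close> satisfies
  \<open>F x \<ge> K x - e \<ge> h x - e\<close>.  Hence \<open>F u \<ge> F v \<ge> F x - h (x - v) \<ge> h x - h (x - v) - e\<close>, and this is at least
  \<open>4 min s t + 2 k s + 2 (m - k - 1) t - e\<close> because \<open>v\<close> is constant on both blocks
  (\<open>log_potential_lower_bound\<close>).  The functions \<open>\<psi>\<^sub>1\<close> and \<open>\<psi>\<^sub>2\<close> at \<open>u\<close> are
  \<open>4 s + 2 k s + 2 (m - k - 1) t - K u\<close> and \<open>4 t + 2 k s + 2 (m - k - 1) t - K u\<close>, so this is the claim on the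
  torus.  Off the torus one of them is \<open>-\<infinity>\<close>.
\<close>

section \<open>Second derivatives and the Levi form\<close>

text \<open>The regularity that the Levi form needs: first derivatives exist
  everywhere, and every directional derivative is again differentiable.  Continuity of the second
  derivatives is not required.\<close>
definition twice_differentiable :: "('v::euclidean_space \<Rightarrow> real) \<Rightarrow> bool"
  where "twice_differentiable f \<longleftrightarrow> (\<forall>x. f differentiable (at x)) \<and>
           (\<forall>v x. (\<lambda>y. frechet_derivative f (at y) v) differentiable (at x))"

lemma smooth_imp_twice_differentiable:
  assumes "smooth f" shows "twice_differentiable f"
proof -
  have "Ck (Suc (Suc 0)) f" using assms unfolding smooth_def by blast
  then show ?thesis by (simp add: twice_differentiable_def)
qed

text \<open>Differentiate in direction \<open>v\<close> first, then in direction \<open>w\<close>.  Bilinearity holds without symmetry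
  of the second derivative.\<close>
definition second_deriv :: "('v::euclidean_space \<Rightarrow> real) \<Rightarrow> 'v \<Rightarrow> 'v \<Rightarrow> 'v \<Rightarrow> real"
  where "second_deriv f x v w = frechet_derivative (\<lambda>y. frechet_derivative f (at y) v) (at x) w"

lemma linear_second_deriv_left:
  assumes f: "twice_differentiable f"
  shows "linear (\<lambda>v. second_deriv f x v w)"
proof -
  have D: "linear (frechet_derivative f (at y))" for y
    using f linear_frechet_derivative by (auto simp: twice_differentiable_def)
  have H: "((\<lambda>y. frechet_derivative f (at y) v) has_derivative
      frechet_derivative (\<lambda>y. frechet_derivative f (at y) v) (at x)) (at x)" for v
    using f by (simp add: twice_differentiable_def flip: frechet_derivative_works)
  show ?thesis
  proof
    fix v v'
    show "second_deriv f x (v + v') w = second_deriv f x v w + second_deriv f x v' w"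
      unfolding second_deriv_def
      using frechet_derivative_at[OF has_derivative_add[OF H[of v] H[of v']]]
      by (simp add: linear_add[OF D] fun_eq_iff)
  next
    fix r v
    show "second_deriv f x (r *\<^sub>R v) w = r *\<^sub>R second_deriv f x v w"
      unfolding second_deriv_def
      using frechet_derivative_at[OF has_derivative_scaleR_right[OF H[of v], of r]]
      by (simp add: linear_scale[OF D] fun_eq_iff)
  qed
qed

lemma linear_second_deriv_right:
  assumes "twice_differentiable f"
  shows "linear (second_deriv f x v)"
  using assms linear_frechet_derivative
  unfolding second_deriv_def twice_differentiable_def by blast

lemma DERIV_along_curve:
  assumes f: "twice_differentiable f"
    and c: "(c has_vector_derivative c') (at s)"
  shows "((\<lambda>s. f (c s)) has_real_derivative frechet_derivative f (at (c s)) c') (at s)"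
proof -
  have "(f has_derivative frechet_derivative f (at (c s))) (at (c s) within range c)"
    using f frechet_derivative_works has_derivative_at_withinI
    unfolding twice_differentiable_def by blast
  from vector_derivative_diff_chain_within[OF c this] show ?thesis
    by (simp add: has_real_derivative_iff_has_vector_derivative o_def)
qed

lemma DERIV2_along_curve:
  fixes f :: "'v::euclidean_space \<Rightarrow> real"
  assumes f: "twice_differentiable f"
    and c: "(c has_vector_derivative d s) (at s)" and d: "(d has_vector_derivative e) (at s)"
  shows "((\<lambda>s. frechet_derivative f (at (c s)) (d s)) has_real_derivative
           second_deriv f (c s) (d s) (d s) + frechet_derivative f (at (c s)) e) (at s)"
proof -
  have D: "linear (frechet_derivative f (at y))" for y
    using f linear_frechet_derivative by (auto simp: twice_differentiable_def)
  have ex: "h v = (\<Sum>b\<in>Basis. (v \<bullet> b) * h b)" if "linear h" for h :: "'v \<Rightarrow> real" and v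
  proof -
    have "h v = h (\<Sum>b\<in>Basis. (v \<bullet> b) *\<^sub>R b)" by (simp add: euclidean_representation)
    then show ?thesis using that by (simp add: linear_sum linear_scale)
  qed
  have 1: "((\<lambda>s. d s \<bullet> b) has_real_derivative e \<bullet> b) (at s)" for b
    using d by (simp add: has_vector_derivative_def has_field_derivative_def)
      (auto intro!: derivative_eq_intros simp: fun_eq_iff)
  have 2: "((\<lambda>s. frechet_derivative f (at (c s)) b) has_real_derivative
             second_deriv f (c s) b (d s)) (at s)" for b
  proof -
    have "((\<lambda>y. frechet_derivative f (at y) b) has_derivative second_deriv f (c s) b)
            (at (c s) within range c)"
      using f frechet_derivative_works has_derivative_at_withinI
      unfolding twice_differentiable_def second_deriv_def by blast
    from vector_derivative_diff_chain_within[OF c this] show ?thesis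
      by (simp add: has_real_derivative_iff_has_vector_derivative o_def)
  qed
  have "((\<lambda>s. \<Sum>b\<in>Basis. (d s \<bullet> b) * frechet_derivative f (at (c s)) b) has_real_derivative
          (\<Sum>b\<in>Basis. (d s \<bullet> b) * second_deriv f (c s) b (d s)
                     + (e \<bullet> b) * frechet_derivative f (at (c s)) b)) (at s)"
    by (rule DERIV_sum) (auto intro!: derivative_eq_intros 1 2)
  moreover have "(\<Sum>b\<in>Basis. (d s \<bullet> b) * second_deriv f (c s) b (d s)
                     + (e \<bullet> b) * frechet_derivative f (at (c s)) b)
      = second_deriv f (c s) (d s) (d s) + frechet_derivative f (at (c s)) e"
    using ex[OF linear_second_deriv_left[OF f, where x = "c s" and w = "d s"], where v = "d s"]
      ex[OF D[of "c s"], where v = e]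
    by (simp add: sum.distrib)
  moreover have "(\<Sum>b\<in>Basis. (d s \<bullet> b) * frechet_derivative f (at (c s)) b)
      = frechet_derivative f (at (c s)) (d s)" for s
    by (rule ex[OF D, symmetric])
  ultimately show ?thesis by simp
qed

text \<open>The real part of the Hermitian form with matrix \<open>H\<close>, in the index convention of \<^const>\<open>pos_def_on\<close>.\<close>
definition levi :: "('n::finite \<Rightarrow> 'n \<Rightarrow> complex) \<Rightarrow> complex ^ 'n \<Rightarrow> real"
  where "levi H v = Re (\<Sum>\<kappa>\<in>UNIV. \<Sum>\<mu>\<in>UNIV. H \<kappa> \<mu> * v $ \<kappa> * cnj (v $ \<mu>))"

lemma vec_as_real_combination:
  fixes v :: "complex ^ 'n::finite"
  shows "v = (\<Sum>l\<in>UNIV. Re (v $ l) *\<^sub>R axis l 1 + Im (v $ l) *\<^sub>R axis l \<i>)"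
proof -
  have "(\<Sum>l\<in>UNIV. Re (v $ l) *\<^sub>R axis l 1 + Im (v $ l) *\<^sub>R axis l \<i>)
      = (\<Sum>l\<in>UNIV. axis l (v $ l))"
    by (intro sum.cong refl) (auto simp: vec_eq_iff axis_def complex_eq_iff)
  also have "\<dots> = v"
    by (simp add: vec_eq_iff axis_def sum.delta)
  finally show ?thesis by simp
qed

lemma ddbar_eq_second_deriv:
  fixes f :: "complex ^ 'n::finite \<Rightarrow> real"
  assumes f: "twice_differentiable f"
  shows "ddbar f x \<kappa> \<mu> =
    (second_deriv f x (axis \<mu> 1) (axis \<kappa> 1) + \<i> * second_deriv f x (axis \<mu> \<i>) (axis \<kappa> 1)
     - \<i> * (second_deriv f x (axis \<mu> 1) (axis \<kappa> \<i>) + \<i> * second_deriv f x (axis \<mu> \<i>) (axis \<kappa> \<i>))) / 4"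
proof -
  have H: "(f has_derivative frechet_derivative f (at y)) (at y)" for y
    using f by (simp add: twice_differentiable_def flip: frechet_derivative_works)
  have H2: "((\<lambda>y. frechet_derivative f (at y) v) has_derivative second_deriv f x v) (at x)" for v
    using f unfolding second_deriv_def
    by (simp add: twice_differentiable_def flip: frechet_derivative_works)
  have 1: "frechet_derivative (\<lambda>y. complex_of_real (f y)) (at y)
      = (\<lambda>v. complex_of_real (frechet_derivative f (at y) v))" for y
    by (rule frechet_derivative_at[OF has_derivative_of_real[OF H[of y]], symmetric])
  have 2: "d_zbar \<mu> (\<lambda>y. complex_of_real (f y)) = (\<lambda>y.
      (frechet_derivative f (at y) (axis \<mu> 1) + \<i> * frechet_derivative f (at y) (axis \<mu> \<i>)) / 2)"
    by (simp add: d_zbar_def 1 fun_eq_iff)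
  have "((\<lambda>y. (complex_of_real (frechet_derivative f (at y) (axis \<mu> 1))
                + \<i> * complex_of_real (frechet_derivative f (at y) (axis \<mu> \<i>))) / 2) has_derivative
        (\<lambda>w. (complex_of_real (second_deriv f x (axis \<mu> 1) w)
             + \<i> * complex_of_real (second_deriv f x (axis \<mu> \<i>) w)) / 2)) (at x)"
    by (auto intro!: derivative_eq_intros has_derivative_of_real H2)
  then show ?thesis
    unfolding ddbar_def 2 d_z_def by (subst (1 2) frechet_derivative_at[symmetric]) (auto simp: field_simps)
qed

text \<open>Four times the Levi form at \<open>v\<close> is the Laplacian of \<open>f\<close> on the complex line through \<open>x\<close> spanned by
  \<open>v\<close>.  The imaginary part, which would need symmetry of the second derivative to vanish, is discarded.\<close>
lemma levi_ddbar:
  fixes f :: "complex ^ 'n::finite \<Rightarrow> real"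
  assumes f: "twice_differentiable f"
  shows "4 * levi (ddbar f x) v = second_deriv f x v v + second_deriv f x (\<i> *s v) (\<i> *s v)"
proof -
  let ?B = "second_deriv f x"
  note left = linear_second_deriv_left[OF f] and right = linear_second_deriv_right[OF f]
  let ?e = "\<lambda>l. axis l (1::complex)" and ?ie = "\<lambda>l. axis l \<i>"
  have ex: "?B v v = (\<Sum>\<kappa>\<in>UNIV. \<Sum>\<mu>\<in>UNIV.
       Re (v $ \<kappa>) * (Re (v $ \<mu>) * ?B (?e \<mu>) (?e \<kappa>) + Im (v $ \<mu>) * ?B (?ie \<mu>) (?e \<kappa>))
     + Im (v $ \<kappa>) * (Re (v $ \<mu>) * ?B (?e \<mu>) (?ie \<kappa>) + Im (v $ \<mu>) * ?B (?ie \<mu>) (?ie \<kappa>)))" for v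
  proof -
    have L: "?B v w = (\<Sum>\<mu>\<in>UNIV. Re (v $ \<mu>) * ?B (?e \<mu>) w + Im (v $ \<mu>) * ?B (?ie \<mu>) w)" for w
      by (subst vec_as_real_combination[of v])
        (simp add: linear_sum[OF left] linear_add[OF left] linear_scale[OF left])
    have R: "?B u v = (\<Sum>\<kappa>\<in>UNIV. Re (v $ \<kappa>) * ?B u (?e \<kappa>) + Im (v $ \<kappa>) * ?B u (?ie \<kappa>))" for u
      by (subst vec_as_real_combination[of v])
        (simp add: linear_sum[OF right] linear_add[OF right] linear_scale[OF right])
    show ?thesis
      by (subst R, subst (1 2) L) (simp add: sum.distrib sum_distrib_left distrib_left)
  qed
  show ?thesis
    unfolding levi_def ex[of v] ex[of "\<i> *s v"] ddbar_eq_second_deriv[OF f]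
    by (simp add: sum_distrib_left flip: sum.distrib) (intro sum.cong refl, simp add: field_simps)
qed

text \<open>The coordinatewise exponential, parametrising the vectors without zero coordinate.\<close>
definition expv :: "('n::finite \<Rightarrow> complex) \<Rightarrow> complex ^ 'n"
  where "expv a = (\<chi> l. exp (a l))"

lemma has_vector_derivative_expv:
  fixes p q d :: "'n::finite \<Rightarrow> complex"
  shows "((\<lambda>s. \<chi> l. d l * exp (p l + q l * of_real s)) has_vector_derivative
           (\<chi> l. d l * q l * exp (p l + q l * of_real s))) (at s)"
proof -
  have *: "((\<lambda>s. d l * exp (p l + q l * of_real s)) has_vector_derivative
           (d l * q l * exp (p l + q l * of_real s))) (at s)" for l
    by (rule has_vector_derivative_real_field) (auto intro!: derivative_eq_intros)
  have "((\<lambda>s. (\<chi> l. d l * exp (p l + q l * of_real s)) \<bullet> b) has_derivative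
     (\<lambda>h. (h *\<^sub>R (\<chi> l. d l * q l * exp (p l + q l * of_real s))) \<bullet> b)) (at s)" 
    if b: "b \<in> Basis" for b :: "complex ^ 'n"
  proof -
    obtain l c where "b = axis l c" using b unfolding Basis_vec_def by blast
    then show ?thesis
      using has_derivative_inner_left[OF *[of l, unfolded has_vector_derivative_def], of c]
      by (simp add: inner_axis)
  qed
  then show ?thesis
    unfolding has_vector_derivative_def by (subst has_derivative_componentwise_within) blast
qed

text \<open>Along the holomorphic curve \<open>\<tau> \<mapsto> expv (p + q \<tau>)\<close> a function that does not depend on \<open>Im \<tau>\<close> has its
  Laplacian equal to its second derivative in \<open>Re \<tau>\<close>; so that second derivative is four times the
  Levi form on the tangent vector of the curve.\<close>
lemma levi_along_exp_curve:
  fixes f :: "complex ^ 'n::finite \<Rightarrow> real" and p q :: "'n \<Rightarrow> complex"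
  assumes f: "twice_differentiable f"
    and inv: "\<And>s t. f (expv (\<lambda>l. p l + q l * of_real s + \<i> * q l * of_real t))
                  = f (expv (\<lambda>l. p l + q l * of_real s))"
  defines "\<xi> \<equiv> \<lambda>s. expv (\<lambda>l. p l + q l * of_real s)"
  shows "\<exists>D. (\<forall>s. ((\<lambda>s. f (\<xi> s)) has_real_derivative D s) (at s)) \<and>
             (\<forall>s. (D has_real_derivative 4 * levi (ddbar f (\<xi> s)) (\<chi> l. q l * \<xi> s $ l)) (at s))"
proof -
  define D where "D = (\<lambda>s::real. frechet_derivative f (at (\<xi> s)) (\<chi> l. q l * \<xi> s $ l))"
  have lin: "linear (frechet_derivative f (at y))" for y
    using f linear_frechet_derivative by (auto simp: twice_differentiable_def)
  have 1: "((\<lambda>s. f (\<xi> s)) has_real_derivative D s) (at s)" for s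
    unfolding D_def
    by (rule DERIV_along_curve[OF f])
       (use has_vector_derivative_expv[of "\<lambda>_. 1" p q s] in \<open>simp add: \<xi>_def expv_def\<close>)
  have 2: "(D has_real_derivative second_deriv f (\<xi> s) (\<chi> l. q l * \<xi> s $ l) (\<chi> l. q l * \<xi> s $ l)
        + frechet_derivative f (at (\<xi> s)) (\<chi> l. q l * q l * \<xi> s $ l)) (at s)" for s
    unfolding D_def
    by (rule DERIV2_along_curve[OF f])
       (use has_vector_derivative_expv[of "\<lambda>_. 1" p q s] has_vector_derivative_expv[of q p q s]
         in \<open>simp_all add: \<xi>_def expv_def\<close>)
  \<comment> \<open>The curve in the direction of \<open>Im \<tau>\<close> has acceleration opposite to that of \<open>\<xi>\<close>; \<open>f\<close> is constant on it.\<close>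
  have 3: "second_deriv f (\<xi> s) (\<i> *s (\<chi> l. q l * \<xi> s $ l)) (\<i> *s (\<chi> l. q l * \<xi> s $ l))
        = frechet_derivative f (at (\<xi> s)) (\<chi> l. q l * q l * \<xi> s $ l)" for s
  proof -
    define p' where "p' = (\<lambda>l. p l + q l * of_real s)"
    define \<chi>' where "\<chi>' = (\<lambda>t::real. expv (\<lambda>l. p' l + (\<i> * q l) * of_real t))"
    define E where "E = (\<lambda>t. frechet_derivative f (at (\<chi>' t)) (\<chi> l. (\<i> * q l) * \<chi>' t $ l))"
    have a: "((\<lambda>t. f (\<chi>' t)) has_real_derivative E t) (at t)" for t
      unfolding E_def
      by (rule DERIV_along_curve[OF f])
         (use has_vector_derivative_expv[of "\<lambda>_. 1" p' "\<lambda>l. \<i> * q l" t] in \<open>simp add: \<chi>'_def expv_def\<close>)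
    have b: "(E has_real_derivative
         second_deriv f (\<chi>' t) (\<chi> l. (\<i> * q l) * \<chi>' t $ l) (\<chi> l. (\<i> * q l) * \<chi>' t $ l)
        + frechet_derivative f (at (\<chi>' t)) (\<chi> l. (\<i> * q l) * (\<i> * q l) * \<chi>' t $ l)) (at t)" for t
      unfolding E_def
      by (rule DERIV2_along_curve[OF f])
         (use has_vector_derivative_expv[of "\<lambda>_. 1" p' "\<lambda>l. \<i> * q l" t]
             has_vector_derivative_expv[of "\<lambda>l. \<i> * q l" p' "\<lambda>l. \<i> * q l" t]
           in \<open>simp_all add: \<chi>'_def expv_def\<close>)
    have c: "f (\<chi>' t) = f (\<xi> s)" for t
      using inv[of s t] by (simp add: \<chi>'_def \<xi>_def p'_def)
    have "E t = 0" for t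
      using DERIV_unique[OF a[of t], of 0] c by simp
    then have "E = (\<lambda>_. 0)" by auto
    then have "second_deriv f (\<chi>' 0) (\<chi> l. (\<i> * q l) * \<chi>' 0 $ l) (\<chi> l. (\<i> * q l) * \<chi>' 0 $ l)
        + frechet_derivative f (at (\<chi>' 0)) (\<chi> l. (\<i> * q l) * (\<i> * q l) * \<chi>' 0 $ l) = 0"
      using DERIV_unique[OF b[of 0], of 0] by simp
    moreover have "\<chi>' 0 = \<xi> s" by (simp add: \<chi>'_def \<xi>_def p'_def)
    moreover have "(\<chi> l. (\<i> * q l) * \<xi> s $ l) = \<i> *s (\<chi> l. q l * \<xi> s $ l)"
      by (simp add: vec_eq_iff)
    moreover have "(\<chi> l. (\<i> * q l) * (\<i> * q l) * \<xi> s $ l) = - (\<chi> l. q l * q l * \<xi> s $ l)"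
      by (simp add: vec_eq_iff algebra_simps)
    ultimately show ?thesis by (simp add: linear_neg[OF lin])
  qed
  show ?thesis
    using 1 2 by (intro exI[of _ D]) (simp add: levi_ddbar[OF f] 3)
qed

section \<open>Pullbacks of the Fubini-Study metric under monomial maps\<close>

text \<open>A map that is real differentiable and, in logarithmic coordinates, becomes the complex linear
  map \<open>T\<close>.  The chart representations of the three projections of \<open>Y\<close> are of this kind,
  which makes the image of an exponential curve an exponential curve.\<close>
definition monomial_map ::
  "(complex ^ 'd::finite \<Rightarrow> complex ^ 'n::finite) \<Rightarrow> (('d \<Rightarrow> complex) \<Rightarrow> 'n \<Rightarrow> complex) \<Rightarrow> bool"
  where "monomial_map F T \<longleftrightarrow> (\<forall>x \<alpha>. (\<lambda>y. F y $ \<alpha>) differentiable (at x)) \<and>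
    (\<forall>a. F (expv a) = expv (T a)) \<and>
    (\<forall>a b c. T (\<lambda>l. a l + b l * c) = (\<lambda>n. T a n + T b n * c))"

lemma monomial_map_derivative:
  assumes F: "monomial_map F T"
  shows "frechet_derivative (\<lambda>y. F y $ \<alpha>) (at (expv a)) (\<chi> l. q l * exp (a l))
           = T q \<alpha> * exp (T a \<alpha>)"
proof -
  let ?c = "\<lambda>s. expv (\<lambda>l. a l + q l * complex_of_real s)"
  have c: "(?c has_vector_derivative (\<chi> l. q l * exp (a l))) (at 0)"
    using has_vector_derivative_expv[of "\<lambda>_. 1" a q 0] by (simp add: expv_def)
  have "((\<lambda>y. F y $ \<alpha>) has_derivative frechet_derivative (\<lambda>y. F y $ \<alpha>) (at (?c 0)))
          (at (?c 0) within range ?c)"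
    using F frechet_derivative_works has_derivative_at_withinI unfolding monomial_map_def by blast
  from vector_derivative_diff_chain_within[OF c this]
  have 1: "((\<lambda>s. F (?c s) $ \<alpha>) has_vector_derivative
      frechet_derivative (\<lambda>y. F y $ \<alpha>) (at (expv a)) (\<chi> l. q l * exp (a l))) (at 0)"
    by (simp add: o_def)
  have "F (?c s) $ \<alpha> = exp (T a \<alpha> + T q \<alpha> * of_real s)" for s
    using F by (simp add: monomial_map_def expv_def)
  moreover have "((\<lambda>s. exp (T a \<alpha> + T q \<alpha> * complex_of_real s)) has_vector_derivative
       T q \<alpha> * exp (T a \<alpha>)) (at 0)"
    by (rule has_vector_derivative_real_field) (auto intro!: derivative_eq_intros)
  ultimately show ?thesis
    using vector_derivative_unique_at[OF 1] by simp
qed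

text \<open>The pulled back Hermitian form on a tangent vector is the original form on its image; the
  holomorphy of \<open>F\<close> at points of the torus is read off from the linearity of \<open>T\<close> over the complex numbers.\<close>
lemma levi_pullback:
  assumes F: "monomial_map F T"
  shows "levi (pullback F g (expv a)) (\<chi> l. q l * exp (a l))
       = levi (g (expv (T a))) (\<chi> n. T q n * exp (T a n))"
proof -
  define v where "v = (\<chi> l. q l * exp (a l))"
  define d where "d \<kappa> \<alpha> = d_z \<kappa> (\<lambda>y. F y $ \<alpha>) (expv a)" for \<kappa> \<alpha>
  have T: "T (\<lambda>l. a l + b l * c) = (\<lambda>n. T a n + T b n * c)" for a b c
    using F by (simp add: monomial_map_def)
  have T0: "T (\<lambda>_. 0) = (\<lambda>_. 0)"
    using T[of "\<lambda>_. 0" "\<lambda>_. 0" 1] by (simp add: fun_eq_iff)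
  have Ti: "T (\<lambda>l. \<i> * q l) = (\<lambda>n. \<i> * T q n)"
    using T[of "\<lambda>_. 0" q \<i>] by (simp add: T0 mult.commute)
  have D: "(\<Sum>\<kappa>\<in>UNIV. d \<kappa> \<alpha> * v $ \<kappa>) = T q \<alpha> * exp (T a \<alpha>)" for \<alpha>
  proof -
    let ?D = "frechet_derivative (\<lambda>y. F y $ \<alpha>) (at (expv a))"
    have lin: "linear ?D"
      using F linear_frechet_derivative by (auto simp: monomial_map_def)
    have ex: "?D v = (\<Sum>l\<in>UNIV. Re (v $ l) * ?D (axis l 1) + Im (v $ l) * ?D (axis l \<i>))" for v
      by (subst vec_as_real_combination[of v])
        (simp add: linear_sum[OF lin] linear_add[OF lin] linear_scale[OF lin]
          scaleR_conv_of_real[where 'a = complex])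
    \<comment> \<open>The operator \<open>\<Sum>\<kappa>. v\<^sub>\<kappa> \<partial>\<^sub>\<kappa>\<close> is half of the derivative along \<open>v\<close> minus \<open>\<i>\<close> times the one along \<open>\<i> v\<close>.\<close>
    have "2 * (\<Sum>\<kappa>\<in>UNIV. d \<kappa> \<alpha> * v $ \<kappa>) = ?D v - \<i> * ?D (\<i> *s v)"
      unfolding ex[of v] ex[of "\<i> *s v"] d_def d_z_def sum_distrib_left
      by (subst sum_subtractf[symmetric], intro sum.cong refl) (simp add: complex_eq_iff field_simps)
    also have "\<i> *s v = (\<chi> l. (\<i> * q l) * exp (a l))" by (simp add: v_def vec_eq_iff)
    also have "?D v - \<i> * ?D \<dots> = 2 * (T q \<alpha> * exp (T a \<alpha>))"
      unfolding v_def monomial_map_derivative[OF F] by (simp add: Ti mult.assoc)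
    finally show ?thesis by simp
  qed
  have Fa: "F (expv a) = expv (T a)" using F by (simp add: monomial_map_def)
  have swap: "(\<Sum>\<kappa>\<in>UNIV. \<Sum>\<mu>\<in>UNIV. (\<Sum>\<alpha>\<in>UNIV. \<Sum>\<beta>\<in>UNIV. h \<alpha> \<beta> * d \<kappa> \<alpha> * cnj (d \<mu> \<beta>)) * v $ \<kappa> * cnj (v $ \<mu>))
     = (\<Sum>\<alpha>\<in>UNIV. \<Sum>\<beta>\<in>UNIV. h \<alpha> \<beta> * (\<Sum>\<kappa>\<in>UNIV. d \<kappa> \<alpha> * v $ \<kappa>) * cnj (\<Sum>\<mu>\<in>UNIV. d \<mu> \<beta> * v $ \<mu>))" for h
  proof -
    have "(\<Sum>\<kappa>\<in>UNIV. \<Sum>\<mu>\<in>UNIV. (\<Sum>\<alpha>\<in>UNIV. \<Sum>\<beta>\<in>UNIV. h \<alpha> \<beta> * d \<kappa> \<alpha> * cnj (d \<mu> \<beta>)) * v $ \<kappa> * cnj (v $ \<mu>))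
      = (\<Sum>\<kappa>\<in>UNIV. \<Sum>\<mu>\<in>UNIV. \<Sum>\<alpha>\<in>UNIV. \<Sum>\<beta>\<in>UNIV. h \<alpha> \<beta> * (d \<kappa> \<alpha> * v $ \<kappa>) * cnj (d \<mu> \<beta> * v $ \<mu>))"
      by (intro sum.cong refl, simp only: sum_distrib_right) (simp only: complex_cnj_mult mult_ac)
    also have "\<dots> = (\<Sum>\<kappa>\<in>UNIV. \<Sum>\<alpha>\<in>UNIV. \<Sum>\<mu>\<in>UNIV. \<Sum>\<beta>\<in>UNIV. h \<alpha> \<beta> * (d \<kappa> \<alpha> * v $ \<kappa>) * cnj (d \<mu> \<beta> * v $ \<mu>))"
      by (intro sum.cong refl, rule sum.swap)
    also have "\<dots> = (\<Sum>\<alpha>\<in>UNIV. \<Sum>\<kappa>\<in>UNIV. \<Sum>\<mu>\<in>UNIV. \<Sum>\<beta>\<in>UNIV. h \<alpha> \<beta> * (d \<kappa> \<alpha> * v $ \<kappa>) * cnj (d \<mu> \<beta> * v $ \<mu>))"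
      by (rule sum.swap)
    also have "\<dots> = (\<Sum>\<alpha>\<in>UNIV. \<Sum>\<kappa>\<in>UNIV. \<Sum>\<beta>\<in>UNIV. \<Sum>\<mu>\<in>UNIV. h \<alpha> \<beta> * (d \<kappa> \<alpha> * v $ \<kappa>) * cnj (d \<mu> \<beta> * v $ \<mu>))"
      by (intro sum.cong refl, rule sum.swap)
    also have "\<dots> = (\<Sum>\<alpha>\<in>UNIV. \<Sum>\<beta>\<in>UNIV. \<Sum>\<kappa>\<in>UNIV. \<Sum>\<mu>\<in>UNIV. h \<alpha> \<beta> * (d \<kappa> \<alpha> * v $ \<kappa>) * cnj (d \<mu> \<beta> * v $ \<mu>))"
      by (intro sum.cong refl, rule sum.swap)
    also have "\<dots> = (\<Sum>\<alpha>\<in>UNIV. \<Sum>\<beta>\<in>UNIV. h \<alpha> \<beta> * (\<Sum>\<kappa>\<in>UNIV. d \<kappa> \<alpha> * v $ \<kappa>) * cnj (\<Sum>\<mu>\<in>UNIV. d \<mu> \<beta> * v $ \<mu>))"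
      by (intro sum.cong refl, simp only: mult.assoc cnj_sum sum_product)
        (simp only: sum_distrib_left mult.assoc)
    finally show ?thesis .
  qed
  have "levi (pullback F g (expv a)) v = levi (g (expv (T a))) (\<chi> n. T q n * exp (T a n))"
    unfolding levi_def pullback_def Fa d_def[symmetric] swap D vec_lambda_beta ..
  then show ?thesis by (simp add: v_def)
qed

text \<open>The potential \<open>ln (\<Sum>l. \<bar>z\<^sub>l\<bar>\<^sup>2)\<close> in the logarithmic coordinates \<open>u\<^sub>l = ln \<bar>z\<^sub>l\<bar>\<close>.\<close>
definition log_sum :: "('n::finite \<Rightarrow> real) \<Rightarrow> real"
  where "log_sum u = ln (\<Sum>l\<in>UNIV. exp (2 * u l))"

text \<open>The potential of the Fubini-Study metric in the affine chart in which coordinate \<open>r\<close> is 1.\<close>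
definition fs_potential :: "'n::finite \<Rightarrow> complex ^ 'n \<Rightarrow> real"
  where "fs_potential r x = ln (1 + (\<Sum>l\<in>UNIV - {r}. (cmod (x $ l))\<^sup>2))"

lemma fubini_study_eq: "fubini_study r = ddbar (fs_potential r)"
  unfolding fubini_study_def fs_potential_def[abs_def] ..

text \<open>The ignored slot \<open>r\<close> holds \<open>exp 0 = 1\<close>, which supplies the summand 1 of the potential.\<close>
lemma fs_potential_expv:
  assumes "a r = 0"
  shows "fs_potential r (expv a) = log_sum (\<lambda>l. Re (a l))"
proof -
  have "(\<Sum>l\<in>UNIV. exp (2 * Re (a l))) = exp (2 * Re (a r)) + (\<Sum>l\<in>UNIV - {r}. exp (2 * Re (a l)))"
    by (rule sum.remove) auto
  moreover have "(cmod (expv a $ l))\<^sup>2 = exp (2 * Re (a l))" for l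
    by (simp add: expv_def exp_double)
  ultimately show ?thesis
    using assms by (simp add: fs_potential_def log_sum_def)
qed

lemma fs_potential_twice_differentiable:
  fixes r :: "'n::finite"
  shows "twice_differentiable (fs_potential r)"
proof -
  let ?N = "\<lambda>x::complex^'n. 1 + (\<Sum>l\<in>UNIV - {r}. (x $ l) \<bullet> (x $ l))"
  have pos: "0 < ?N x" for x
    by (intro add_pos_nonneg sum_nonneg) auto
  have nth: "((\<lambda>x::complex^'n. x $ l) has_derivative (\<lambda>v. v $ l)) (at x)" for l x
    by (rule bounded_linear_imp_has_derivative[OF bounded_linear_vec_nth])
  have 0: "fs_potential r = (\<lambda>x. ln (?N x))"
    by (simp add: fs_potential_def fun_eq_iff power2_norm_eq_inner)
  have N: "(?N has_derivative (\<lambda>v. \<Sum>l\<in>UNIV - {r}. 2 * ((x $ l) \<bullet> (v $ l)))) (at x)" for x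
    by (auto intro!: derivative_eq_intros nth simp: inner_commute)
  have 1: "(fs_potential r has_derivative
         (\<lambda>v. (\<Sum>l\<in>UNIV - {r}. 2 * ((x $ l) \<bullet> (v $ l))) / ?N x)) (at x)" for x
    unfolding 0 divide_inverse by (rule has_derivative_ln[OF pos N])
  have 2: "frechet_derivative (fs_potential r) (at x)
        = (\<lambda>v. (\<Sum>l\<in>UNIV - {r}. 2 * ((x $ l) \<bullet> (v $ l))) / ?N x)" for x
    by (rule frechet_derivative_at[OF 1, symmetric])
  have 3: "(\<lambda>x::complex^'n. \<Sum>l\<in>UNIV - {r}. 2 * ((x $ l) \<bullet> (v $ l))) differentiable (at x)" for v x
  proof -
    have "((\<lambda>x::complex^'n. \<Sum>l\<in>UNIV - {r}. 2 * ((x $ l) \<bullet> (v $ l))) has_derivative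
        (\<lambda>w. \<Sum>l\<in>UNIV - {r}. 2 * ((w $ l) \<bullet> (v $ l)))) (at x)"
      by (auto intro!: derivative_eq_intros simp: nth)
    then show ?thesis using differentiable_def by blast
  qed
  have 4: "?N differentiable (at x)" for x using N differentiable_def by blast
  show ?thesis
    unfolding twice_differentiable_def 2
  proof (intro conjI allI)
    show "fs_potential r differentiable (at x)" for x
      using 1 differentiable_def by blast
    show "(\<lambda>x. (\<Sum>l\<in>UNIV - {r}. 2 * ((x $ l) \<bullet> (v $ l))) / ?N x) differentiable (at x)" for v x
      using pos[of x] by (intro differentiable_divide 3 4) simp
  qed
qed

lemma log_sum_second_derivative:
  fixes p q :: "'d::finite \<Rightarrow> complex" and T :: "('d \<Rightarrow> complex) \<Rightarrow> 'n::finite \<Rightarrow> complex"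
  assumes F: "monomial_map F T"
    and slot: "T p r = 0" "T q r = 0" and real: "\<And>n. Im (T q n) = 0"
  defines "\<xi> \<equiv> \<lambda>s. expv (\<lambda>l. p l + q l * of_real s)"
  shows "\<exists>D. (\<forall>s. ((\<lambda>s. log_sum (\<lambda>n. Re (T p n) + Re (T q n) * s)) has_real_derivative D s) (at s)) \<and>
     (\<forall>s. (D has_real_derivative
        4 * levi (pullback F (fubini_study r) (\<xi> s)) (\<chi> l. q l * \<xi> s $ l)) (at s))"
proof -
  have T: "T (\<lambda>l. a l + b l * c) = (\<lambda>n. T a n + T b n * c)" for a b c
    using F by (simp add: monomial_map_def)
  have 1: "fs_potential r (expv (\<lambda>n. T p n + T q n * of_real s)) 
      = log_sum (\<lambda>n. Re (T p n) + Re (T q n) * s)" for s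
    by (subst fs_potential_expv) (simp_all add: slot)
  have 2: "fs_potential r (expv (\<lambda>n. T p n + T q n * of_real s + \<i> * T q n * of_real t)) 
      = log_sum (\<lambda>n. Re (T p n) + Re (T q n) * s)" for s t
    by (subst fs_potential_expv) (simp_all add: slot real)
  have 3: "levi (pullback F g (\<xi> s)) (\<chi> l. q l * \<xi> s $ l)
      = levi (g (expv (\<lambda>n. T p n + T q n * of_real s)))
          (\<chi> n. T q n * expv (\<lambda>n. T p n + T q n * of_real s) $ n)" for g s
    using levi_pullback[OF F, of g "\<lambda>l. p l + q l * of_real s" q]
    by (simp add: \<xi>_def T expv_def)
  show ?thesis
    using levi_along_exp_curve[OF fs_potential_twice_differentiable, of r "T p" "T q"]
    by (simp add: 1 2 3 fubini_study_eq)
qed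

lemma levi_nonneg:
  assumes H: "pos_def_on (UNIV - {p}) H" and v: "v $ p = 0"
  shows "0 \<le> levi H v"
proof -
  have "levi H v = Re (\<Sum>\<kappa>\<in>UNIV - {p}. \<Sum>\<mu>\<in>UNIV - {p}. H \<kappa> \<mu> * v $ \<kappa> * cnj (v $ \<mu>))"
  proof -
    have *: "sum h UNIV = sum h (UNIV - {p})" if "h p = 0" for h :: "'a \<Rightarrow> complex"
      using that by (intro sum.mono_neutral_right) auto
    have "levi H v = Re (\<Sum>\<kappa>\<in>UNIV. \<Sum>\<mu>\<in>UNIV - {p}. H \<kappa> \<mu> * v $ \<kappa> * cnj (v $ \<mu>))"
      unfolding levi_def by (intro arg_cong[of _ _ Re] sum.cong refl *) (simp add: v)
    also have "\<dots> = Re (\<Sum>\<kappa>\<in>UNIV - {p}. \<Sum>\<mu>\<in>UNIV - {p}. H \<kappa> \<mu> * v $ \<kappa> * cnj (v $ \<mu>))"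
      by (intro arg_cong[of _ _ Re] *) (simp add: v)
    finally show ?thesis .
  qed
  also have "\<dots> \<ge> 0"
  proof (cases "\<exists>\<kappa>\<in>UNIV - {p}. v $ \<kappa> \<noteq> 0")
    case True
    with H have "0 < Re (\<Sum>\<kappa>\<in>UNIV - {p}. \<Sum>\<mu>\<in>UNIV - {p}. H \<kappa> \<mu> * v $ \<kappa> * cnj (v $ \<mu>))"
      unfolding pos_def_on_def by blast
    then show ?thesis by simp
  next
    case False
    then show ?thesis by simp
  qed
  finally show ?thesis .
qed

section \<open>The complex torus in \<open>Y\<close> and the group action\<close>

text \<open>The projections \<^const>\<open>zeta_lift\<close>, \<^const>\<open>eta_lift\<close> and \<^const>\<open>z_lift\<close> (in the charts with \<open>p = Inl i\<close>) expressed
  in logarithmic coordinates.\<close>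
definition log_zeta :: "'a \<Rightarrow> ('a + 'b \<Rightarrow> complex) \<Rightarrow> 'a \<Rightarrow> complex"
  where "log_zeta i a l = (if l = i then 0 else a (Inl l))"

definition log_eta :: "'b \<Rightarrow> ('a + 'b \<Rightarrow> complex) \<Rightarrow> 'b \<Rightarrow> complex"
  where "log_eta j a q = (if q = j then 0 else a (Inr q))"

definition log_z :: "'a \<Rightarrow> 'b \<Rightarrow> ('a + 'b \<Rightarrow> complex) \<Rightarrow> 'a + 'b \<Rightarrow> complex"
  where "log_z i j a n = (case n of Inl l \<Rightarrow> log_zeta i a l | Inr q \<Rightarrow> a (Inr j) + log_eta j a q)"

lemma differentiable_vec_nth: "(\<lambda>y :: complex ^ 'n::finite. y $ l) differentiable (at x)"
  using bounded_linear_imp_differentiable[OF bounded_linear_vec_nth] .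

lemma monomial_map_differentiable:
  "monomial_map F T \<Longrightarrow> (\<lambda>y. F y $ \<alpha>) differentiable (at x)"
  by (simp add: monomial_map_def)

lemma monomial_map_expv: "monomial_map F T \<Longrightarrow> F (expv a) = expv (T a)"
  by (simp add: monomial_map_def)

lemma monomial_map_affine:
  "monomial_map F T \<Longrightarrow> T (\<lambda>l. a l + b l * c) = (\<lambda>n. T a n + T b n * c)"
  by (simp add: monomial_map_def)

lemma monomial_map_zeta_lift:
  "monomial_map (zeta_lift i :: complex ^ ('a::finite + 'b::finite) \<Rightarrow> complex ^ 'a) (log_zeta i)"
  unfolding monomial_map_def
proof (intro conjI allI)
  show "(\<lambda>y. zeta_lift i y $ l) differentiable (at x)" for x :: "complex ^ ('a + 'b)" and l
    by (cases "l = i") (simp_all add: zeta_lift_def aff_def fst_block_def differentiable_vec_nth)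
qed (auto simp: zeta_lift_def log_zeta_def aff_def fst_block_def expv_def vec_eq_iff)

lemma monomial_map_eta_lift:
  "monomial_map (eta_lift j :: complex ^ ('a::finite + 'b::finite) \<Rightarrow> complex ^ 'b) (log_eta j)"
  unfolding monomial_map_def
proof (intro conjI allI)
  show "(\<lambda>y. eta_lift j y $ q) differentiable (at x)" for x :: "complex ^ ('a + 'b)" and q
    by (cases "q = j") (simp_all add: eta_lift_def aff_def snd_block_def differentiable_vec_nth)
qed (auto simp: eta_lift_def log_eta_def aff_def snd_block_def expv_def vec_eq_iff)

lemma monomial_map_z_lift:
  fixes i :: "'a::finite" and j :: "'b::finite"
  shows "monomial_map (z_lift (Inl i) i j) (log_z i j)"
  unfolding monomial_map_def
proof (intro conjI allI)
  have zeta: "(\<lambda>y. zeta_lift i y $ l) differentiable (at x)" for l and x :: "complex ^ ('a + 'b)"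
    by (rule monomial_map_differentiable[OF monomial_map_zeta_lift])
  have eta: "(\<lambda>y. eta_lift j y $ l) differentiable (at x)" for l and x :: "complex ^ ('a + 'b)"
    by (rule monomial_map_differentiable[OF monomial_map_eta_lift])
  show "(\<lambda>y. z_lift (Inl i) i j y $ n) differentiable (at x)" for x :: "complex ^ ('a + 'b)" and n
    by (cases n) (auto simp: z_lift_def aff_def
        intro!: differentiable_mult zeta eta differentiable_vec_nth)
  show "z_lift (Inl i) i j (expv a) = expv (log_z i j a)" for a
    by (auto simp: vec_eq_iff z_lift_def log_z_def expv_def zeta_lift_def eta_lift_def aff_def
        log_zeta_def log_eta_def fst_block_def snd_block_def exp_add split: sum.split)
  show "log_z i j (\<lambda>l. a l + b l * c) = (\<lambda>n. log_z i j a n + log_z i j b n * c)" for a b c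
    by (auto simp: fun_eq_iff log_z_def log_zeta_def log_eta_def algebra_simps split: sum.split)
qed

text \<open>The point of \<open>Y\<close> with homogeneous coordinates \<open>z\<^sub>n = exp (a\<^sub>n)\<close>; these points form the open orbit of the
  complex torus.\<close>
definition torus_pt :: "('a::finite + 'b::finite \<Rightarrow> complex) \<Rightarrow> ('a, 'b) triple"
  where "torus_pt a = (pt (expv a), pt (expv (a \<circ> Inl)), pt (expv (a \<circ> Inr)))"

lemma expv_shift: "expv (\<lambda>n. a n + c) = exp c *s expv a"
  by (simp add: expv_def vec_eq_iff exp_add)

lemma pt_expv_shift: "pt (expv (\<lambda>n. a n + c)) = pt (expv a)"
  by (simp add: expv_shift pt_scale)

lemma torus_pt_shift: "torus_pt (\<lambda>n. a n + c) = torus_pt a"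
  unfolding torus_pt_def o_def pt_expv_shift ..

lemma chart_expv: "chart (Inl i) i j (expv a) = torus_pt (log_z i j a)"
proof -
  have "log_z i j a \<circ> Inl = log_zeta i a" "log_z i j a \<circ> Inr = (\<lambda>q. log_eta j a q + a (Inr j))"
    by (auto simp: log_z_def fun_eq_iff)
  then show ?thesis
    by (simp add: chart_def torus_pt_def pt_expv_shift monomial_map_expv[OF monomial_map_z_lift]
        monomial_map_expv[OF monomial_map_zeta_lift] monomial_map_expv[OF monomial_map_eta_lift])
qed

lemma expv_nonzero: "expv a \<noteq> 0"
  by (simp add: expv_def vec_eq_iff)

lemma torus_pt_in_Y: "torus_pt a \<in> Y"
proof -
  have "fst_block (expv a) = 1 *s expv (a \<circ> Inl)" "snd_block (expv a) = 1 *s expv (a \<circ> Inr)"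
    by (simp_all add: fst_block_def snd_block_def expv_def vec_eq_iff)
  then have "Y_coords (expv a) (expv (a \<circ> Inl)) (expv (a \<circ> Inr))"
    unfolding Y_coords_def by (intro conjI expv_nonzero) blast+
  then show ?thesis unfolding Y_def torus_pt_def by blast
qed

lemma image_pt:
  assumes "\<And>c z. h (c *s z) = c *s h z"
  shows "h ` pt z = pt (h z)"
  by (auto simp: pt_def image_iff assms)

lemma rotate_coord_pt: "rotate_coord l \<theta> ` pt z = pt (rotate_coord l \<theta> z)"
  by (rule image_pt) (auto simp: rotate_coord_def vec_eq_iff)

lemma exchange_pt: "exchange l l' ` pt z = pt (exchange l l' z)"
  by (rule image_pt) (auto simp: exchange_def vec_eq_iff)

lemma exchange_expv: "exchange l l' (expv a) = expv (a \<circ> Transposition.transpose l l')"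
  by (simp add: exchange_def expv_def)

lemma G_invariantD: "G_invariant \<phi> \<Longrightarrow> g \<in> G \<Longrightarrow> y \<in> Y \<Longrightarrow> \<phi> (g y) = \<phi> y"
  by (simp add: G_invariant_def)

text \<open>The generators of \<^const>\<open>G\<close> only have angles in \<open>[0, 2\<pi>]\<close>; \<open>\<theta>\<close> is the representative of \<open>t\<close>
  modulo \<open>2\<pi>\<close>.\<close>
lemma G_invariant_rotate:
  assumes G: "G_invariant \<phi>"
  shows "\<phi> (torus_pt (a(l := a l + \<i> * of_real t))) = \<phi> (torus_pt a)"
proof -
  define \<theta> where "\<theta> = Arg2pi (exp (\<i> * of_real t))"
  have \<theta>: "\<theta> \<in> {0..2 * pi}" using Arg2pi[of "exp (\<i> * of_real t)"] by (simp add: \<theta>_def)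
  have e: "exp (\<i> * of_real \<theta>) = exp (\<i> * of_real t)"
    unfolding \<theta>_def by (subst complex_norm_eq_1_exp[symmetric]) (simp add: norm_exp_i_times)
  have rot: "rotate_coord r \<theta> (expv b) = expv (b(r := b r + \<i> * of_real t))"
    for r :: "'c::finite" and b
    by (simp add: rotate_coord_def expv_def vec_eq_iff e exp_add)
  show ?thesis
  proof (cases l)
    case (Inl i)
    have "(a(l := a l + \<i> * of_real t)) \<circ> Inl = (a \<circ> Inl)(i := (a \<circ> Inl) i + \<i> * of_real t)"
      "(a(l := a l + \<i> * of_real t)) \<circ> Inr = a \<circ> Inr"
      by (auto simp: Inl)
    then have eq: "torus_pt (a(l := a l + \<i> * of_real t))
      = (\<lambda>(P, Q, R). (rotate_coord (Inl i) \<theta> ` P, rotate_coord i \<theta> ` Q, R)) (torus_pt a)"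
      by (simp add: torus_pt_def rotate_coord_pt rot Inl)
    show ?thesis
      unfolding eq by (rule G_invariantD[OF G G_rotate_fst[OF \<theta>] torus_pt_in_Y])
  next
    case (Inr j)
    have "(a(l := a l + \<i> * of_real t)) \<circ> Inr = (a \<circ> Inr)(j := (a \<circ> Inr) j + \<i> * of_real t)"
      "(a(l := a l + \<i> * of_real t)) \<circ> Inl = a \<circ> Inl"
      by (auto simp: Inr)
    then have eq: "torus_pt (a(l := a l + \<i> * of_real t))
      = (\<lambda>(P, Q, R). (rotate_coord (Inr j) \<theta> ` P, Q, rotate_coord j \<theta> ` R)) (torus_pt a)"
      by (simp add: torus_pt_def rotate_coord_pt rot Inr)
    show ?thesis
      unfolding eq by (rule G_invariantD[OF G G_rotate_snd[OF \<theta>] torus_pt_in_Y])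
  qed
qed

lemma G_invariant_rotate_all:
  assumes G: "G_invariant \<phi>"
  shows "\<phi> (torus_pt (\<lambda>n. a n + \<i> * of_real (t n))) = \<phi> (torus_pt a)"
proof -
  have "\<phi> (torus_pt (\<lambda>n. if n \<in> S then a n + \<i> * of_real (t n) else a n)) = \<phi> (torus_pt a)"
    if "finite S" for S
    using that
  proof (induction S rule: finite_induct)
    case empty
    then show ?case by simp
  next
    case (insert l S)
    let ?b = "\<lambda>n. if n \<in> S then a n + \<i> * of_real (t n) else a n"
    have "(\<lambda>n. if n \<in> insert l S then a n + \<i> * of_real (t n) else a n)
        = ?b(l := ?b l + \<i> * of_real (t l))"
      using insert.hyps by (auto simp: fun_eq_iff)
    then show ?case using G_invariant_rotate[OF G, of ?b l "t l"] insert.IH by simp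
  qed
  from this[of UNIV] show ?thesis by simp
qed

text \<open>Only exchanges within a block are allowed; the disjunction treats both blocks at once.\<close>
lemma G_invariant_exchange:
  assumes G: "G_invariant \<phi>" and "x = Inl i \<and> y = Inl i' \<or> x = Inr j \<and> y = Inr j'"
  shows "\<phi> (torus_pt (a \<circ> Transposition.transpose x y)) = \<phi> (torus_pt a)"
  using assms(2)
proof
  assume xy: "x = Inl i \<and> y = Inl i'"
  have "(a \<circ> Transposition.transpose x y) \<circ> Inl = (a \<circ> Inl) \<circ> Transposition.transpose i i'"
    "(a \<circ> Transposition.transpose x y) \<circ> Inr = a \<circ> Inr"
    by (auto simp: xy fun_eq_iff Transposition.transpose_def)
  then have eq: "torus_pt (a \<circ> Transposition.transpose x y)
      = (\<lambda>(P, Q, R). (exchange (Inl i) (Inl i') ` P, exchange i i' ` Q, R)) (torus_pt a)"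
    by (simp add: torus_pt_def exchange_pt exchange_expv xy)
  show ?thesis
    unfolding eq by (rule G_invariantD[OF G G_exchange_fst torus_pt_in_Y])
next
  assume xy: "x = Inr j \<and> y = Inr j'"
  have "(a \<circ> Transposition.transpose x y) \<circ> Inr = (a \<circ> Inr) \<circ> Transposition.transpose j j'"
    "(a \<circ> Transposition.transpose x y) \<circ> Inl = a \<circ> Inl"
    by (auto simp: xy fun_eq_iff Transposition.transpose_def)
  then have eq: "torus_pt (a \<circ> Transposition.transpose x y)
      = (\<lambda>(P, Q, R). (exchange (Inr j) (Inr j') ` P, Q, exchange j j' ` R)) (torus_pt a)"
    by (simp add: torus_pt_def exchange_pt exchange_expv xy)
  show ?thesis
    unfolding eq by (rule G_invariantD[OF G G_exchange_snd torus_pt_in_Y])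
qed

section \<open>Convexity of the potential in logarithmic coordinates\<close>

text \<open>The potential of \<^const>\<open>g_hat\<close> on the torus, homogenised: it is a function of \<open>ln \<bar>z\<^sub>n\<bar>\<close> for all the
  homogeneous coordinates and differs from the potential in a chart by a linear function.\<close>
definition ref_potential :: "nat \<Rightarrow> nat \<Rightarrow> ('a::finite + 'b::finite \<Rightarrow> real) \<Rightarrow> real"
  where "ref_potential m k u =
    2 * log_sum u + real k * log_sum (u \<circ> Inl) + real (m - k - 1) * log_sum (u \<circ> Inr)"

text \<open>The potential of the metric modified by \<open>\<phi>\<close>, as a function on the real vector space of logarithms of moduli.\<close>
definition log_potential ::
  "nat \<Rightarrow> nat \<Rightarrow> (('a::finite, 'b::finite) triple \<Rightarrow> real) \<Rightarrow> ('a + 'b \<Rightarrow> real) \<Rightarrow> real"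
  where "log_potential m k \<phi> u = ref_potential m k u + \<phi> (torus_pt (\<lambda>n. complex_of_real (u n)))"

lemma log_sum_shift: "log_sum (\<lambda>n. u n + c) = log_sum u + 2 * c"
proof -
  have "(\<Sum>l\<in>UNIV. exp (2 * (u l + c))) = exp (2 * c) * (\<Sum>l\<in>UNIV. exp (2 * u l))"
    by (simp add: sum_distrib_left exp_add[symmetric] algebra_simps)
  moreover have "(\<Sum>l\<in>UNIV. exp (2 * u l)) > 0" by (intro sum_pos) auto
  ultimately show ?thesis by (simp add: log_sum_def ln_mult)
qed

lemma levi_add: "levi (\<lambda>\<kappa> \<mu>. A \<kappa> \<mu> + B \<kappa> \<mu>) v = levi A v + levi B v"
  by (simp only: levi_def distrib_right sum.distrib Re_complex_of_real plus_complex.sel)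

lemma levi_scale: "levi (\<lambda>\<kappa> \<mu>. of_real c * A \<kappa> \<mu>) v = c * levi A v"
proof -
  have "(\<Sum>\<kappa>\<in>UNIV. \<Sum>\<mu>\<in>UNIV. of_real c * A \<kappa> \<mu> * v $ \<kappa> * cnj (v $ \<mu>))
      = of_real c * (\<Sum>\<kappa>\<in>UNIV. \<Sum>\<mu>\<in>UNIV. A \<kappa> \<mu> * v $ \<kappa> * cnj (v $ \<mu>))"
    by (simp only: sum_distrib_left mult.assoc)
  then show ?thesis by (simp add: levi_def)
qed

lemma levi_g_hat:
  "levi (\<lambda>\<kappa> \<mu>. g_hat m k p i j x \<kappa> \<mu> + H \<kappa> \<mu>) v =
     2 * levi (pullback (z_lift p i j) (fubini_study p) x) v
   + real k * levi (pullback (zeta_lift i) (fubini_study i) x) v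
   + real (m - k - 1) * levi (pullback (eta_lift j) (fubini_study j) x) v + levi H v"
proof -
  have "g_hat m k p i j x \<kappa> \<mu> =
      of_real 2 * pullback (z_lift p i j) (fubini_study p) x \<kappa> \<mu>
    + of_real (real k) * pullback (zeta_lift i) (fubini_study i) x \<kappa> \<mu>
    + of_real (real (m - k - 1)) * pullback (eta_lift j) (fubini_study j) x \<kappa> \<mu>" for \<kappa> \<mu>
    by (simp add: g_hat_def)
  then show ?thesis by (simp only: levi_add levi_scale)
qed

text \<open>A plurisubharmonic function invariant under the compact torus is convex in the logarithms of the
  moduli; positivity in a single chart suffices, since every chart covers the
  complex torus.\<close>
lemma convex_on_log_potential:
  fixes \<phi> :: "('a::finite, 'b::finite) triple \<Rightarrow> real" and u w :: "'a + 'b \<Rightarrow> real"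
  assumes sm: "smooth_on_Y \<phi>" and adm: "admissible m k \<phi>" and G: "G_invariant \<phi>"
  shows "convex_on UNIV (\<lambda>s. log_potential m k \<phi> (\<lambda>n. u n + s * w n))"
proof -
  obtain i :: 'a and j :: 'b where True by simp
  \<comment> \<open>\<open>L u\<close>: logarithms of the chart coordinates of the point with homogeneous coordinates \<open>exp (u\<^sub>n)\<close>.\<close>
  define L where "L = (\<lambda>(u :: 'a + 'b \<Rightarrow> real) n. complex_of_real (case n of
      Inl l \<Rightarrow> if l = i then 0 else u (Inl l) - u (Inl i)
    | Inr q \<Rightarrow> if q = j then u (Inr j) - u (Inl i) else u (Inr q) - u (Inr j)))"
  define \<xi> where "\<xi> = (\<lambda>s. expv (\<lambda>l. L u l + L w l * complex_of_real s))"
  define v where "v = (\<lambda>s. \<chi> l. L w l * \<xi> s $ l)"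
  define f where "f = (\<lambda>x. \<phi> (chart (Inl i) i j x))"
  have z: "log_z i j (L u) n = u n - u (Inl i)"
    and zeta: "log_zeta i (L u) l = u (Inl l) - u (Inl i)"
    and eta: "log_eta j (L u) q = u (Inr q) - u (Inr j)" for u n l q
    by (auto simp: log_z_def log_zeta_def log_eta_def L_def split: sum.split)
  have L_slot: "L w (Inl i) = 0" by (simp add: L_def)
  have z_lin: "log_z i j (\<lambda>l. a l + b l * c) = (\<lambda>n. log_z i j a n + log_z i j b n * c)" for a b c
    by (rule monomial_map_affine[OF monomial_map_z_lift])
  have in_atlas: "(Inl i, i, j) \<in> atlas" by (simp add: atlas_def)
  have f: "twice_differentiable f"
    using sm in_atlas smooth_imp_twice_differentiable unfolding smooth_on_Y_def f_def by blast
  have fval: "f (expv (\<lambda>l. L u l + L w l * of_real s))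
      = \<phi> (torus_pt (\<lambda>n. complex_of_real (u n + s * w n)))" for s
  proof -
    have "log_z i j (\<lambda>l. L u l + L w l * of_real s)
        = (\<lambda>n. complex_of_real (u n + s * w n) + complex_of_real (- u (Inl i) - s * w (Inl i)))"
      by (simp only: z_lin z) (simp add: algebra_simps)
    then show ?thesis by (simp only: f_def chart_expv torus_pt_shift)
  qed
  have finv: "f (expv (\<lambda>l. L u l + L w l * of_real s + \<i> * L w l * of_real t))
      = f (expv (\<lambda>l. L u l + L w l * of_real s))" for s t
  proof -
    have "log_z i j (\<lambda>l. L u l + L w l * of_real s + \<i> * L w l * of_real t)
        = log_z i j (\<lambda>l. (L u l + L w l * of_real s) + L w l * (\<i> * of_real t))"
      by (simp add: mult_ac)
    also have "\<dots> = (\<lambda>n. log_z i j (\<lambda>l. L u l + L w l * of_real s) n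
                      + \<i> * of_real ((w n - w (Inl i)) * t))"
      by (subst z_lin) (simp add: z mult_ac)
    finally show ?thesis
      by (simp only: f_def chart_expv G_invariant_rotate_all[OF G])
  qed
  \<comment> \<open>The three pieces of the chart potential and \<open>\<phi>\<close>, along the line \<open>u + s w\<close>.\<close>
  define g1 where "g1 s = log_sum (\<lambda>n. (u n - u (Inl i)) + (w n - w (Inl i)) * s)" for s
  define g2 where "g2 s = log_sum (\<lambda>l. (u (Inl l) - u (Inl i)) + (w (Inl l) - w (Inl i)) * s)" for s
  define g3 where "g3 s = log_sum (\<lambda>q. (u (Inr q) - u (Inr j)) + (w (Inr q) - w (Inr j)) * s)" for s
  define g4 where "g4 s = \<phi> (torus_pt (\<lambda>n. complex_of_real (u n + s * w n)))" for s
  have "\<exists>D. (\<forall>s. (g1 has_real_derivative D s) (at s)) \<and> (\<forall>s. (D has_real_derivative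
         4 * levi (pullback (z_lift (Inl i) i j) (fubini_study (Inl i)) (\<xi> s)) (v s)) (at s))"
    using log_sum_second_derivative[OF monomial_map_z_lift[of i j], of "L u" "Inl i" "L w"]
    by (simp add: z g1_def[abs_def] \<xi>_def v_def)
  then obtain D1 where D1: "\<And>s. (g1 has_real_derivative D1 s) (at s)"
      "\<And>s. (D1 has_real_derivative
         4 * levi (pullback (z_lift (Inl i) i j) (fubini_study (Inl i)) (\<xi> s)) (v s)) (at s)"
    by blast
  have "\<exists>D. (\<forall>s. (g2 has_real_derivative D s) (at s)) \<and> (\<forall>s. (D has_real_derivative
         4 * levi (pullback (zeta_lift i) (fubini_study i) (\<xi> s)) (v s)) (at s))"
    using log_sum_second_derivative[OF monomial_map_zeta_lift[of i], of "L u" i "L w"]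
    by (simp add: zeta g2_def[abs_def] \<xi>_def v_def)
  then obtain D2 where D2: "\<And>s. (g2 has_real_derivative D2 s) (at s)"
      "\<And>s. (D2 has_real_derivative
         4 * levi (pullback (zeta_lift i) (fubini_study i) (\<xi> s)) (v s)) (at s)"
    by blast
  have "\<exists>D. (\<forall>s. (g3 has_real_derivative D s) (at s)) \<and> (\<forall>s. (D has_real_derivative
         4 * levi (pullback (eta_lift j) (fubini_study j) (\<xi> s)) (v s)) (at s))"
    using log_sum_second_derivative[OF monomial_map_eta_lift[of j], of "L u" j "L w"]
    by (simp add: eta g3_def[abs_def] \<xi>_def v_def)
  then obtain D3 where D3: "\<And>s. (g3 has_real_derivative D3 s) (at s)"
      "\<And>s. (D3 has_real_derivative
         4 * levi (pullback (eta_lift j) (fubini_study j) (\<xi> s)) (v s)) (at s)"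
    by blast
  obtain D4 where D4: "\<And>s. (g4 has_real_derivative D4 s) (at s)"
      "\<And>s. (D4 has_real_derivative 4 * levi (ddbar f (\<xi> s)) (v s)) (at s)"
    using levi_along_exp_curve[OF f, of "L u" "L w", OF finv]
    unfolding fval g4_def[abs_def] v_def \<xi>_def by blast
  have F: "log_potential m k \<phi> (\<lambda>n. u n + s * w n) =
      2 * (g1 s + 2 * (u (Inl i) + s * w (Inl i)))
    + real k * (g2 s + 2 * (u (Inl i) + s * w (Inl i)))
    + real (m - k - 1) * (g3 s + 2 * (u (Inr j) + s * w (Inr j))) + g4 s" for s
  proof -
    have "log_sum (\<lambda>n. u n + s * w n) = g1 s + 2 * (u (Inl i) + s * w (Inl i))"
      unfolding g1_def by (subst log_sum_shift[symmetric]) (simp add: algebra_simps)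
    moreover have "log_sum ((\<lambda>n. u n + s * w n) \<circ> Inl) = g2 s + 2 * (u (Inl i) + s * w (Inl i))"
      unfolding g2_def by (subst log_sum_shift[symmetric]) (simp add: algebra_simps o_def)
    moreover have "log_sum ((\<lambda>n. u n + s * w n) \<circ> Inr) = g3 s + 2 * (u (Inr j) + s * w (Inr j))"
      unfolding g3_def by (subst log_sum_shift[symmetric]) (simp add: algebra_simps o_def)
    ultimately show ?thesis
      by (simp only: log_potential_def ref_potential_def g4_def)
  qed
  have d1: "((\<lambda>s. log_potential m k \<phi> (\<lambda>n. u n + s * w n)) has_real_derivative
      2 * (D1 s + 2 * w (Inl i)) + real k * (D2 s + 2 * w (Inl i))
      + real (m - k - 1) * (D3 s + 2 * w (Inr j)) + D4 s) (at s)" for s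
    unfolding F by (auto intro!: derivative_eq_intros D1(1) D2(1) D3(1) D4(1) simp: algebra_simps)
  have d2: "((\<lambda>s. 2 * (D1 s + 2 * w (Inl i)) + real k * (D2 s + 2 * w (Inl i))
      + real (m - k - 1) * (D3 s + 2 * w (Inr j)) + D4 s) has_real_derivative
      4 * levi (\<lambda>\<kappa> \<mu>. g_hat m k (Inl i) i j (\<xi> s) \<kappa> \<mu> + ddbar f (\<xi> s) \<kappa> \<mu>) (v s)) (at s)" for s
    unfolding levi_g_hat
    by (rule DERIV_cong, (rule DERIV_add DERIV_cmult DERIV_const D1(2) D2(2) D3(2) D4(2))+)
      (simp add: algebra_simps)
  have d3: "0 \<le> 4 * levi (\<lambda>\<kappa> \<mu>. g_hat m k (Inl i) i j (\<xi> s) \<kappa> \<mu> + ddbar f (\<xi> s) \<kappa> \<mu>) (v s)" for s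
  proof -
    have "pos_def_on (UNIV - {Inl i})
        (\<lambda>\<kappa> \<mu>. g_hat m k (Inl i) i j (\<xi> s) \<kappa> \<mu> + ddbar f (\<xi> s) \<kappa> \<mu>)"
      using adm in_atlas unfolding admissible_def f_def by blast
    moreover have "v s $ Inl i = 0" by (simp add: v_def L_slot)
    ultimately show ?thesis by (simp add: levi_nonneg)
  qed
  show ?thesis by (rule f''_ge0_imp_convex[OF convex_UNIV d1 d2 d3])
qed

section \<open>Averaging and growth of the potential\<close>

text \<open>Averaging the coordinates in \<open>S\<close> does not increase a convex function symmetric in them.  Instead of
  averaging over all permutations, one coordinate above the mean and one below it are moved towards
  each other by the same amount until the former is the mean; the new point is a convex combination
  of the old one and its transposition, and fewer coordinates differ from the mean.\<close>
lemma averaging_decreases_convex_symmetric: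
  fixes F :: "('n::finite \<Rightarrow> real) \<Rightarrow> real"
  assumes conv: "\<And>u w. convex_on UNIV (\<lambda>s. F (\<lambda>n. u n + s * w n))"
    and sym: "\<And>u x y. x \<in> S \<Longrightarrow> y \<in> S \<Longrightarrow> F (u \<circ> Transposition.transpose x y) = F u"
    and mean: "sum u S = of_nat (card S) * c"
  shows "F (\<lambda>n. if n \<in> S then c else u n) \<le> F u"
  using mean
proof (induction "card {n \<in> S. u n \<noteq> c}" arbitrary: u rule: less_induct)
  case less
  show ?case
  proof (cases "\<forall>n\<in>S. u n = c")
    case True
    then have "(\<lambda>n. if n \<in> S then c else u n) = u" by auto
    then show ?thesis by simp
  next
    case False
    have zero: "(\<Sum>n\<in>S. u n - c) = 0"
      using less.prems by (simp add: sum_subtractf)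
    obtain x where x: "x \<in> S" "u x > c"
    proof (rule ccontr)
      assume "\<not> thesis"
      then have le: "\<forall>n\<in>S. 0 \<le> c - u n" using that by force
      have "(\<Sum>n\<in>S. c - u n) = 0" using zero by (simp add: sum_subtractf)
      then have "\<forall>n\<in>S. c - u n = 0" using le by (subst (asm) sum_nonneg_eq_0_iff) auto
      then show False using False by auto
    qed
    obtain y where y: "y \<in> S" "u y < c"
    proof (rule ccontr)
      assume "\<not> thesis"
      then have le: "\<forall>n\<in>S. 0 \<le> u n - c" using that by force
      then have "\<forall>n\<in>S. u n - c = 0" using zero by (subst (asm) sum_nonneg_eq_0_iff) auto
      then show False using False by auto
    qed
    have xy: "x \<noteq> y" using x y by auto
    define t where "t = (u x - c) / (u x - u y)"
    have t: "0 \<le> t" "t \<le> 1" using x y by (auto simp: t_def divide_simps)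
    define u' where "u' = u(x := c, y := u y + (u x - c))"
    let ?w = "\<lambda>n. (u \<circ> Transposition.transpose x y) n - u n"
    have tm: "t * (u x - u y) = u x - c" using x y by (simp add: t_def)
    then have tm': "t * (u y - u x) = c - u x" by (simp add: algebra_simps)
    have u': "u' = (\<lambda>n. u n + t * ?w n)"
      using xy tm tm' by (auto simp: u'_def fun_eq_iff Transposition.transpose_def)
    have "F u' \<le> (1 - t) * F u + t * F (u \<circ> Transposition.transpose x y)"
      using convex_onD[OF conv[of u ?w] t, of 0 1] by (simp add: u' o_def)
    also have "\<dots> = F u" by (simp add: sym[OF x(1) y(1)] algebra_simps)
    finally have Fu': "F u' \<le> F u" .
    have "sum u' S = sum u S"
    proof -
      have "sum f S = f x + f y + sum f (S - {x, y})" for f :: "'n \<Rightarrow> real"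
        using xy x(1) y(1) sum.subset_diff[of "{x, y}" S f] by simp
      moreover have "sum u' (S - {x, y}) = sum u (S - {x, y})"
        by (intro sum.cong) (auto simp: u'_def)
      ultimately show ?thesis using xy by (simp add: u'_def)
    qed
    moreover have "card {n \<in> S. u' n \<noteq> c} < card {n \<in> S. u n \<noteq> c}"
    proof (rule psubset_card_mono)
      show "{n \<in> S. u' n \<noteq> c} \<subset> {n \<in> S. u n \<noteq> c}"
        using x y xy by (auto simp: u'_def)
    qed simp
    ultimately have "F (\<lambda>n. if n \<in> S then c else u' n) \<le> F u'"
      using less.hyps[of u'] less.prems by simp
    also have "(\<lambda>n. if n \<in> S then c else u' n) = (\<lambda>n. if n \<in> S then c else u n)"
      using x(1) y(1) by (auto simp: u'_def)
    finally show ?thesis using Fu' by simp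
  qed
qed

text \<open>The slopes of a convex function increase, so a linear bound of slope \<open>h\<close> near infinity bounds all of
  them.\<close>
lemma convex_growth_bound:
  assumes conv: "convex_on UNIV (f :: real \<Rightarrow> real)" and bound: "\<And>T. T \<ge> 0 \<Longrightarrow> f T \<le> C + T * h"
  shows "f 1 \<le> f 0 + h"
proof (rule ccontr)
  assume "\<not> f 1 \<le> f 0 + h"
  then have d: "f 1 - f 0 - h > 0" (is "?d > 0") by simp
  have R: "C - f 0 \<ge> 0" (is "?R \<ge> 0") using bound[of 0] by simp
  \<comment> \<open>A \<open>t \<in> (0, 1]\<close> with \<open>t * (C - f 0) < f 1 - f 0 - h\<close>.\<close>
  define t where "t = ?d / (?d + ?R + 1)"
  have t: "0 < t" "t \<le> 1" using d R by (auto simp: t_def)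
  have "f 1 \<le> (1 - t) * f 0 + t * f (1 / t)"
    using convex_onD[OF conv, of t 0 "1 / t"] t by simp
  also have "\<dots> \<le> (1 - t) * f 0 + t * (C + (1 / t) * h)"
    using bound[of "1 / t"] t by (intro add_left_mono mult_left_mono) auto
  also have "\<dots> = f 0 + h + t * ?R" using t by (simp add: algebra_simps)
  finally have "?d \<le> t * ?R" by simp
  then have "?d * (?d + ?R + 1) \<le> ?d * ?R" using d R by (simp add: t_def divide_simps)
  then have "?d + ?R + 1 \<le> ?R" using d by (metis mult_le_cancel_left_pos)
  then show False using d by simp
qed

lemma log_sum_growth:
  assumes w: "\<And>n. w n \<le> M" and T: "T \<ge> 0"
  shows "log_sum (\<lambda>n. v n + T * w n) \<le> log_sum v + 2 * T * M"
proof -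
  have "(\<Sum>l\<in>UNIV. exp (2 * (v l + T * w l))) \<le> (\<Sum>l\<in>UNIV. exp (2 * (v l + T * M)))"
    using w T by (intro sum_mono) (simp add: mult_left_mono)
  moreover have "(\<Sum>l\<in>UNIV. exp (2 * (v l + T * w l))) > 0" by (intro sum_pos) auto
  ultimately have "log_sum (\<lambda>n. v n + T * w n) \<le> log_sum (\<lambda>n. v n + T * M)"
    by (simp add: log_sum_def)
  then show ?thesis by (simp add: log_sum_shift)
qed

lemma log_sum_ge: "2 * u n \<le> log_sum u"
proof -
  have "exp (2 * u n) \<le> (\<Sum>l\<in>UNIV. exp (2 * u l))"
    by (intro member_le_sum) auto
  then show ?thesis
    unfolding log_sum_def by (subst ln_ge_iff) (auto intro: less_le_trans[OF exp_gt_zero])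
qed

lemma log_potential_exchange:
  assumes G: "G_invariant \<phi>" and xy: "x = Inl i \<and> y = Inl i' \<or> x = Inr j \<and> y = Inr j'"
  shows "log_potential m k \<phi> (u \<circ> Transposition.transpose x y) = log_potential m k \<phi> u"
proof -
  have sum: "log_sum (v \<circ> Transposition.transpose r r') = log_sum v" for v :: "'c::finite \<Rightarrow> real" and r r'
  proof -
    have "bij (Transposition.transpose r r')" by simp
    from sum.reindex_bij_betw[OF this, of "\<lambda>l. exp (2 * v l)"] show ?thesis
      by (simp add: log_sum_def)
  qed
  have l: "log_sum ((u \<circ> Transposition.transpose x y) \<circ> Inl) = log_sum (u \<circ> Inl)"
  proof -
    have "(u \<circ> Transposition.transpose x y) \<circ> Inl = u \<circ> Inl \<or>
        (u \<circ> Transposition.transpose x y) \<circ> Inl = (u \<circ> Inl) \<circ> Transposition.transpose i i'"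
      using xy by (auto simp: fun_eq_iff Transposition.transpose_def)
    then show ?thesis using sum[of "u \<circ> Inl" i i'] by auto
  qed
  have r: "log_sum ((u \<circ> Transposition.transpose x y) \<circ> Inr) = log_sum (u \<circ> Inr)"
  proof -
    have "(u \<circ> Transposition.transpose x y) \<circ> Inr = u \<circ> Inr \<or>
        (u \<circ> Transposition.transpose x y) \<circ> Inr = (u \<circ> Inr) \<circ> Transposition.transpose j j'"
      using xy by (auto simp: fun_eq_iff Transposition.transpose_def)
    then show ?thesis using sum[of "u \<circ> Inr" j j'] by auto
  qed
  have "\<phi> (torus_pt (\<lambda>n. complex_of_real ((u \<circ> Transposition.transpose x y) n)))
      = \<phi> (torus_pt (\<lambda>n. complex_of_real (u n)))"
    using G_invariant_exchange[OF G xy, of "\<lambda>n. complex_of_real (u n)"] by (simp add: o_def)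
  then show ?thesis
    by (simp only: log_potential_def ref_potential_def sum l r)
qed

lemma log_potential_ge_at_means:
  fixes \<phi> :: "('a::finite, 'b::finite) triple \<Rightarrow> real"
  assumes sm: "smooth_on_Y \<phi>" and adm: "admissible m k \<phi>" and G: "G_invariant \<phi>"
    and s: "(\<Sum>i\<in>UNIV. u (Inl i)) = of_nat CARD('a) * s"
    and t: "(\<Sum>j\<in>UNIV. u (Inr j)) = of_nat CARD('b) * t"
  shows "log_potential m k \<phi> (case_sum (\<lambda>_. s) (\<lambda>_. t)) \<le> log_potential m k \<phi> u"
proof -
  let ?F = "log_potential m k \<phi>"
  let ?A = "range Inl :: ('a + 'b) set" and ?B = "range Inr :: ('a + 'b) set"
  note conv = convex_on_log_potential[OF sm adm G]
  let ?u = "\<lambda>n. if n \<in> ?A then s else u n"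
  have "?F ?u \<le> ?F u"
  proof (rule averaging_decreases_convex_symmetric[OF conv])
    show "sum u ?A = of_nat (card ?A) * s"
      using s by (simp add: sum.reindex card_image)
    show "?F (v \<circ> Transposition.transpose x y) = ?F v" if "x \<in> ?A" "y \<in> ?A" for v x y
      using that log_potential_exchange[OF G] by blast
  qed
  moreover have "?F (\<lambda>n. if n \<in> ?B then t else ?u n) \<le> ?F ?u"
  proof (rule averaging_decreases_convex_symmetric[OF conv])
    have "(\<Sum>j\<in>UNIV. ?u (Inr j)) = of_nat CARD('b) * t"
      using t by (simp add: image_iff)
    then show "sum ?u ?B = of_nat (card ?B) * t"
      by (simp add: sum.reindex card_image o_def)
    show "?F (v \<circ> Transposition.transpose x y) = ?F v" if "x \<in> ?B" "y \<in> ?B" for v x y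
      using that log_potential_exchange[OF G] by blast
  qed
  moreover have "(\<lambda>n. if n \<in> ?B then t else ?u n) = case_sum (\<lambda>_. s) (\<lambda>_. t)"
    by (auto simp: fun_eq_iff image_iff split: sum.split)
  ultimately show ?thesis by simp
qed

text \<open>The right-hand side is the support function of the moment polytope of the reference metric.  As
  \<open>\<phi> \<le> 0\<close>, the potential is bounded above by the reference potential, whose growth in the
  direction \<open>w\<close> that function bounds.\<close>
lemma log_potential_growth:
  fixes \<phi> :: "('a::finite, 'b::finite) triple \<Rightarrow> real"
  assumes sm: "smooth_on_Y \<phi>" and adm: "admissible m k \<phi>" and G: "G_invariant \<phi>"
    and nonpos: "\<And>y. y \<in> Y \<Longrightarrow> \<phi> y \<le> 0"
    and A: "\<And>i. w (Inl i) \<le> A" and B: "\<And>j. w (Inr j) \<le> B"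
  shows "log_potential m k \<phi> (\<lambda>n. v n + w n)
      \<le> log_potential m k \<phi> v + (4 * max A B + 2 * real k * A + 2 * real (m - k - 1) * B)"
proof -
  let ?h = "4 * max A B + 2 * real k * A + 2 * real (m - k - 1) * B"
  have "log_potential m k \<phi> (\<lambda>n. v n + T * w n) \<le> ref_potential m k v + T * ?h" if T: "T \<ge> 0" for T
  proof -
    have M: "w n \<le> max A B" for n
      using A B by (cases n) (auto simp: le_max_iff_disj)
    have "log_potential m k \<phi> (\<lambda>n. v n + T * w n) \<le> ref_potential m k (\<lambda>n. v n + T * w n)"
      using nonpos[OF torus_pt_in_Y] by (simp add: log_potential_def)
    also have "\<dots> \<le> 2 * (log_sum v + 2 * T * max A B) + real k * (log_sum (v \<circ> Inl) + 2 * T * A)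
        + real (m - k - 1) * (log_sum (v \<circ> Inr) + 2 * T * B)"
      unfolding ref_potential_def o_def
      by (intro add_mono mult_left_mono log_sum_growth M A B T) auto
    also have "\<dots> = ref_potential m k v + T * ?h"
      by (simp add: ref_potential_def algebra_simps)
    finally show ?thesis .
  qed
  from convex_growth_bound[OF convex_on_log_potential[OF sm adm G, of v w] this]
  show ?thesis by simp
qed

section \<open>Density of the torus and the lower bound\<close>

lemma Y_coords_torus_pt:
  assumes Y: "Y_coords z \<zeta> \<eta>" and nz: "\<And>n. z $ n \<noteq> 0"
  shows "(pt z, pt \<zeta>, pt \<eta>) = torus_pt (\<lambda>n. Ln (z $ n))"
proof -
  obtain s t where s: "fst_block z = s *s \<zeta>" and t: "snd_block z = t *s \<eta>"
    using Y by (auto simp: Y_coords_def)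
  have z: "expv (\<lambda>n. Ln (z $ n)) = z" "expv ((\<lambda>n. Ln (z $ n)) \<circ> Inl) = fst_block z"
    "expv ((\<lambda>n. Ln (z $ n)) \<circ> Inr) = snd_block z"
    using nz by (simp_all add: expv_def vec_eq_iff fst_block_def snd_block_def)
  have "s \<noteq> 0" using s nz[of "Inl undefined"] by (auto simp: vec_eq_iff fst_block_def)
  moreover have "t \<noteq> 0" using t nz[of "Inr undefined"] by (auto simp: vec_eq_iff snd_block_def)
  ultimately show ?thesis by (simp add: torus_pt_def z s t pt_scale)
qed

lemma G_invariant_at_moduli:
  assumes Y: "Y_coords z \<zeta> \<eta>" and nz: "\<And>n. z $ n \<noteq> 0" and G: "G_invariant \<phi>"
  shows "\<phi> (pt z, pt \<zeta>, pt \<eta>) = \<phi> (torus_pt (\<lambda>n. complex_of_real (ln (cmod (z $ n)))))"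
proof -
  have "Ln (z $ n) = complex_of_real (ln (cmod (z $ n))) + \<i> * of_real (Im (Ln (z $ n)))" for n
    using nz[of n] by (simp add: complex_eq_iff)
  then have "\<phi> (torus_pt (\<lambda>n. Ln (z $ n)))
      = \<phi> (torus_pt (\<lambda>n. complex_of_real (ln (cmod (z $ n))) + \<i> * of_real (Im (Ln (z $ n)))))"
    by presburger
  also have "\<dots> = \<phi> (torus_pt (\<lambda>n. complex_of_real (ln (cmod (z $ n)))))"
    by (rule G_invariant_rotate_all[OF G])
  finally show ?thesis by (simp add: Y_coords_torus_pt[OF Y nz])
qed

lemma Y_coords_lifts:
  assumes p: "p = Inl i \<or> p = Inr j"
  shows "Y_coords (z_lift p i j x) (zeta_lift i x) (eta_lift j x)"
proof -
  have "z_lift p i j x $ p = 1" "zeta_lift i x $ i = 1" "eta_lift j x $ j = 1"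
    using p by (auto simp: z_lift_def zeta_lift_def eta_lift_def aff_def)
  then have "z_lift p i j x \<noteq> 0" "zeta_lift i x \<noteq> 0" "eta_lift j x \<noteq> 0" by auto
  moreover have "fst_block (z_lift p i j x) = (aff p x $ Inl i) *s zeta_lift i x"
      "snd_block (z_lift p i j x) = (aff p x $ Inr j) *s eta_lift j x"
    by (auto simp: fst_block_def snd_block_def z_lift_def vec_eq_iff)
  ultimately show ?thesis unfolding Y_coords_def by blast
qed

text \<open>Replacing the vanishing chart coordinates by a small positive number \<open>d\<close> leads into the torus and
  changes \<open>\<phi>\<close> little.\<close>
lemma dense_torus:
  fixes \<phi> :: "('a::finite, 'b::finite) triple \<Rightarrow> real"
  assumes sm: "smooth_on_Y \<phi>" and G: "G_invariant \<phi>" and y: "y \<in> Y" and c: "c < \<phi> y"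
  obtains u :: "'a + 'b \<Rightarrow> real" where "c < \<phi> (torus_pt (\<lambda>n. complex_of_real (u n)))"
proof -
  obtain p i j x where p: "p = Inl i \<or> p = Inr j" and yx: "y = chart p i j x"
    using y unfolding Y_eq_charts by (auto simp: atlas_def)
  have "Ck 0 (\<lambda>x. \<phi> (chart p i j x))"
    using sm p unfolding smooth_on_Y_def atlas_def smooth_def by blast
  then have cont: "isCont (\<lambda>x. \<phi> (chart p i j x)) x"
    by (simp add: continuous_on_eq_continuous_at)
  define X where "X d = (\<chi> l. if x $ l = 0 then complex_of_real d else x $ l)" for d
  have "(X \<longlongrightarrow> x) (at_right 0)"
  proof (rule vec_tendstoI)
    fix l
    have "((\<lambda>d. if x $ l = 0 then complex_of_real d else x $ l) \<longlongrightarrow> x $ l) (at_right 0)"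
      by (cases "x $ l = 0") (auto intro!: tendsto_eq_intros)
    then show "((\<lambda>d. X d $ l) \<longlongrightarrow> x $ l) (at_right 0)" by (simp add: X_def)
  qed
  from isCont_tendsto_compose[OF cont this]
  have "eventually (\<lambda>d. c < \<phi> (chart p i j (X d))) (at_right 0)"
    using c unfolding yx by (rule order_tendstoD)
  moreover have "eventually (\<lambda>d::real. d > 0) (at_right 0)"
    by (simp add: eventually_at_right_less)
  ultimately have "eventually (\<lambda>d. c < \<phi> (chart p i j (X d)) \<and> d > 0) (at_right (0::real))"
    by (rule eventually_conj)
  then obtain d where d: "c < \<phi> (chart p i j (X d))" "d > 0"
    using eventually_happens'[of "at_right (0::real)"] by auto
  have nzX: "X d $ l \<noteq> 0" for l using d(2) by (simp add: X_def)
  have nz: "z_lift p i j (X d) $ n \<noteq> 0" for n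
    by (cases n) (auto simp: z_lift_def zeta_lift_def eta_lift_def aff_def fst_block_def
        snd_block_def nzX)
  show ?thesis
    using that d(1) G_invariant_at_moduli[OF Y_coords_lifts[OF p] nz G] unfolding chart_def by simp
qed

text \<open>Here \<open>s\<close> and \<open>t\<close> are the means of the two blocks of \<open>u\<close>.  The point \<open>x\<close> of the proof nearly realises
  \<open>sup \<phi> = 0\<close>; the potential there is at least the support function at \<open>x\<close>, up to \<open>e\<close>, and going from
  the mean point \<open>?v\<close> to \<open>x\<close> raises the potential by at most the support function at \<open>x - ?v\<close>.\<close>
lemma log_potential_lower_bound:
  fixes \<phi> :: "('a::finite, 'b::finite) triple \<Rightarrow> real"
  assumes sm: "smooth_on_Y \<phi>" and adm: "admissible m k \<phi>" and G: "G_invariant \<phi>"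
    and sup: "(SUP y\<in>Y. ereal (\<phi> y)) = 0"
    and s: "(\<Sum>i\<in>UNIV. u (Inl i)) = of_nat CARD('a) * s"
    and t: "(\<Sum>j\<in>UNIV. u (Inr j)) = of_nat CARD('b) * t"
  shows "4 * min s t + 2 * real k * s + 2 * real (m - k - 1) * t \<le> log_potential m k \<phi> u"
proof (rule field_le_epsilon)
  fix e :: real assume e: "e > 0"
  have nonpos: "\<phi> y \<le> 0" if "y \<in> Y" for y
    using SUP_upper[OF that, of "\<lambda>y. ereal (\<phi> y)"] sup by simp
  have "ereal (- e) < (SUP y\<in>Y. ereal (\<phi> y))" using e sup by simp
  then obtain y where y: "y \<in> Y" "- e < \<phi> y" by (auto simp: less_SUP_iff)
  obtain x :: "'a + 'b \<Rightarrow> real" where x: "- e < \<phi> (torus_pt (\<lambda>n. complex_of_real (x n)))"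
    using dense_torus[OF sm G y] .
  define A where "A = (MAX i. x (Inl i))"
  define B where "B = (MAX j. x (Inr j))"
  have A: "x (Inl i) \<le> A" and B: "x (Inr j) \<le> B" for i j
    unfolding A_def B_def by (auto intro!: Max_ge)
  have "A \<in> range (\<lambda>i. x (Inl i))" "B \<in> range (\<lambda>j. x (Inr j))"
    unfolding A_def B_def by (rule Max_in; simp)+
  then obtain i j where ij: "A = x (Inl i)" "B = x (Inr j)" by blast
  let ?v = "case_sum (\<lambda>_. s) (\<lambda>_. t) :: 'a + 'b \<Rightarrow> real"
  have low: "4 * max A B + 2 * real k * A + 2 * real (m - k - 1) * B \<le> ref_potential m k x"
  proof -
    have "2 * max A B \<le> log_sum x"
      using log_sum_ge[of x "Inl i"] log_sum_ge[of x "Inr j"] by (simp add: ij max_def)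
    moreover have "real k * (2 * A) \<le> real k * log_sum (x \<circ> Inl)"
      using log_sum_ge[of "x \<circ> Inl" i] by (intro mult_left_mono) (auto simp: ij)
    moreover have "real (m - k - 1) * (2 * B) \<le> real (m - k - 1) * log_sum (x \<circ> Inr)"
      using log_sum_ge[of "x \<circ> Inr" j] by (intro mult_left_mono) (auto simp: ij)
    ultimately show ?thesis by (simp add: ref_potential_def)
  qed
  have "log_potential m k \<phi> (\<lambda>n. ?v n + (x n - ?v n)) \<le> log_potential m k \<phi> ?v
      + (4 * max (A - s) (B - t) + 2 * real k * (A - s) + 2 * real (m - k - 1) * (B - t))"
    using A B by (intro log_potential_growth[OF sm adm G nonpos]) auto
  then have "ref_potential m k x - e \<le> log_potential m k \<phi> ?v
      + (4 * max (A - s) (B - t) + 2 * real k * (A - s) + 2 * real (m - k - 1) * (B - t))"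
    using x by (simp add: log_potential_def)
  moreover have "min s t \<le> max A B - max (A - s) (B - t)" by (auto simp: min_def max_def)
  moreover have "log_potential m k \<phi> ?v \<le> log_potential m k \<phi> u"
    by (rule log_potential_ge_at_means[OF sm adm G s t])
  ultimately show "4 * min s t + 2 * real k * s + 2 * real (m - k - 1) * t
      \<le> log_potential m k \<phi> u + e"
    using low by (simp add: algebra_simps)
qed

section \<open>The functions \<open>\<psi>\<^sub>1\<close> and \<open>\<psi>\<^sub>2\<close> in logarithmic coordinates\<close>

lemma ln_sq_sum:
  assumes "\<And>l. z $ l \<noteq> 0"
  shows "ln (sq_sum z) = log_sum (\<lambda>l. ln (cmod (z $ l)))"
  using assms by (simp add: sq_sum_def log_sum_def exp_double)

lemma sq_sum_pos: "z $ l \<noteq> 0 \<Longrightarrow> 0 < sq_sum z"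
  unfolding sq_sum_def by (rule sum_pos2[where i = l]) auto

lemma abs_prod_pos: "(\<And>l. z $ l \<noteq> 0) \<Longrightarrow> 0 < abs_prod z"
  unfolding abs_prod_def by (rule prod_pos) simp

lemma ln_abs_prod:
  assumes "\<And>l. z $ l \<noteq> 0"
  shows "ln (abs_prod z) = (\<Sum>l\<in>UNIV. ln (cmod (z $ l)))"
  unfolding abs_prod_def using assms by (intro ln_prod) auto

text \<open>The factor is homogeneous of degree 0 in \<open>\<zeta>\<close>, so it can be evaluated at the multiple \<open>x\<close> of \<open>\<zeta>\<close>.\<close>
lemma ln_block_factor:
  fixes x \<zeta> :: "complex ^ 'n::finite"
  assumes x: "x = c *s \<zeta>" and nz: "\<And>l. x $ l \<noteq> 0" and d: "CARD('n) = Suc d"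
  shows "0 < abs_prod \<zeta> powr (2 * real d / real (Suc d)) / sq_sum \<zeta> ^ d"
    and "ln (abs_prod \<zeta> powr (2 * real d / real (Suc d)) / sq_sum \<zeta> ^ d)
      = 2 * real d / real (Suc d) * (\<Sum>l\<in>UNIV. ln (cmod (x $ l)))
        - real d * log_sum (\<lambda>l. ln (cmod (x $ l)))"
proof -
  have cancel: "2 * real d / real (Suc d) * (a + real (Suc d) * b) =
    2 * real d / real (Suc d) * a + 2 * real d * b" for a b
    by (simp add: field_simps)
  have c: "c \<noteq> 0" and nz': "\<zeta> $ l \<noteq> 0" for l
    using x nz by auto
  have ln: "ln (cmod (x $ l)) = ln (cmod (\<zeta> $ l)) + ln (cmod c)" for l
    using c nz'[of l] by (simp add: x norm_mult ln_mult)
  have pos: "0 < abs_prod \<zeta>" "0 < sq_sum \<zeta>"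
    using abs_prod_pos[OF nz'] sq_sum_pos[OF nz'] by auto
  then show "0 < abs_prod \<zeta> powr (2 * real d / real (Suc d)) / sq_sum \<zeta> ^ d" by simp
  have "ln (abs_prod \<zeta> powr (2 * real d / real (Suc d)) / sq_sum \<zeta> ^ d)
      = 2 * real d / real (Suc d) * (\<Sum>l\<in>UNIV. ln (cmod (\<zeta> $ l)))
        - real d * log_sum (\<lambda>l. ln (cmod (\<zeta> $ l)))"
    using pos by (simp add: ln_div ln_powr ln_realpow ln_abs_prod[OF nz'] ln_sq_sum[OF nz'])
  moreover have "(\<Sum>l\<in>UNIV. ln (cmod (x $ l)))
      = (\<Sum>l\<in>UNIV. ln (cmod (\<zeta> $ l))) + real (Suc d) * ln (cmod c)"
    by (simp add: ln sum.distrib d)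
  moreover have "log_sum (\<lambda>l. ln (cmod (x $ l))) = log_sum (\<lambda>l. ln (cmod (\<zeta> $ l))) + 2 * ln (cmod c)"
    unfolding ln by (rule log_sum_shift)
  ultimately show "ln (abs_prod \<zeta> powr (2 * real d / real (Suc d)) / sq_sum \<zeta> ^ d)
      = 2 * real d / real (Suc d) * (\<Sum>l\<in>UNIV. ln (cmod (x $ l)))
        - real d * log_sum (\<lambda>l. ln (cmod (x $ l)))"
    by (simp only: cancel) (simp add: algebra_simps)
qed

lemma ln_ext_mult3:
  "0 < a \<Longrightarrow> 0 < b \<Longrightarrow> 0 < c \<Longrightarrow> ln_ext (a * b * c) = ereal (ln a + ln b + ln c)"
  by (simp add: ln_ext_def ln_mult)

theorem mainTheorem5:
  fixes m k :: nat
    and \<phi> :: "('a::finite, 'b::finite) triple \<Rightarrow> real"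
  assumes "m \<ge> 2" and "k \<in> {1..m - 1}"
    and "CARD('a) = k + 1" and "CARD('b) = m - k"
    and "smooth_on_Y \<phi>"
    and "admissible m k \<phi>"
    and "G_invariant \<phi>"
    and "(SUP y\<in>Y. ereal (\<phi> y)) = 0"
  shows "\<forall>z \<zeta> \<eta>. Y_coords z \<zeta> \<eta> \<longrightarrow> ereal (\<phi> (pt z, pt \<zeta>, pt \<eta>)) \<ge> psi_hat m k z \<zeta> \<eta>"
proof (intro allI impI)
  fix z :: "complex ^ ('a + 'b)" and \<zeta> :: "complex ^ 'a" and \<eta> :: "complex ^ 'b"
  assume Y: "Y_coords z \<zeta> \<eta>"
  show "psi_hat m k z \<zeta> \<eta> \<le> ereal (\<phi> (pt z, pt \<zeta>, pt \<eta>))"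
  proof (cases "\<forall>n. z $ n \<noteq> 0")
    case False
    then obtain n where n: "z $ n = 0" by blast
    \<comment> \<open>\<open>0 powr e = 0\<close>, so a vanishing coordinate in a block makes the corresponding function \<open>-\<infinity>\<close>.\<close>
    have "psi1 m k z \<zeta> \<eta> = -\<infinity> \<or> psi2 m k z \<zeta> \<eta> = -\<infinity>"
    proof (cases n)
      case (Inl i)
      then have "abs_prod (fst_block z) = 0"
        using n by (auto simp: abs_prod_def fst_block_def)
      then show ?thesis by (simp add: psi1_def ln_ext_def)
    next
      case (Inr j)
      then have "abs_prod (snd_block z) = 0"
        using n by (auto simp: abs_prod_def snd_block_def)
      then show ?thesis by (simp add: psi2_def ln_ext_def)
    qed
    then show ?thesis by (auto simp: psi_hat_def)
  next
    case True
    then have nz: "z $ n \<noteq> 0" for n by blast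
    obtain c d where c: "fst_block z = c *s \<zeta>" and d: "snd_block z = d *s \<eta>"
      using Y by (auto simp: Y_coords_def)
    define u where "u n = ln (cmod (z $ n))" for n
    define s where "s = (\<Sum>i\<in>UNIV. u (Inl i)) / (real k + 1)"
    define t where "t = (\<Sum>j\<in>UNIV. u (Inr j)) / (real m - real k)"
    have km: "k < m" using assms(1,2) by auto
    have card: "CARD('a) = Suc k" "CARD('b) = Suc (m - k - 1)"
      "real (Suc k) = real k + 1" "real (Suc (m - k - 1)) = real m - real k"
      "real (m - k - 1) = real m - real k - 1"
      using assms(3,4) km by (auto simp: of_nat_diff)
    have mk: "real m - real k > 0" using km by simp
    have sum_s: "(\<Sum>i\<in>UNIV. u (Inl i)) = (real k + 1) * s"
      by (simp add: s_def)
    have sum_t: "(\<Sum>j\<in>UNIV. u (Inr j)) = (real m - real k) * t"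
      using mk by (simp add: t_def)
    have nzf: "fst_block z $ i \<noteq> 0" and nzs: "snd_block z $ j \<noteq> 0" for i j
      by (simp_all add: fst_block_def snd_block_def nz)
    have uf: "ln (cmod (fst_block z $ i)) = u (Inl i)" and us: "ln (cmod (snd_block z $ j)) = u (Inr j)" for i j
      by (simp_all add: fst_block_def snd_block_def u_def)
    have bound: "4 * min s t + 2 * real k * s + 2 * real (m - k - 1) * t
        \<le> ref_potential m k u + \<phi> (pt z, pt \<zeta>, pt \<eta>)"
    proof -
      have "(\<Sum>i\<in>UNIV. u (Inl i)) = of_nat CARD('a) * s" "(\<Sum>j\<in>UNIV. u (Inr j)) = of_nat CARD('b) * t"
        using sum_s sum_t by (simp_all only: card)
      from log_potential_lower_bound[OF assms(5-8) this]
      show ?thesis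
        by (simp only: log_potential_def G_invariant_at_moduli[OF Y nz assms(7)] u_def[symmetric])
    qed
    note f1 = ln_block_factor[OF c nzf card(1), unfolded uf card]
    note f2 = ln_block_factor[OF d nzs card(2), unfolded us card]
    have sq: "0 < sq_sum z" "ln (sq_sum z) = log_sum u"
      using sq_sum_pos[OF nz] ln_sq_sum[OF nz] by (auto simp: u_def[abs_def])
    have pf: "0 < abs_prod (fst_block z)" "ln (abs_prod (fst_block z)) = (real k + 1) * s"
      using abs_prod_pos[OF nzf] ln_abs_prod[OF nzf] by (auto simp: uf sum_s)
    have ps: "0 < abs_prod (snd_block z)" "ln (abs_prod (snd_block z)) = (real m - real k) * t"
      using abs_prod_pos[OF nzs] ln_abs_prod[OF nzs] by (auto simp: us sum_t)
    have F1: "ln (abs_prod \<zeta> powr (2 * real k / (real k + 1)) / sq_sum \<zeta> ^ k)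
        = 2 * real k * s - real k * log_sum (u \<circ> Inl)"
      using f1(2) by (simp add: sum_s o_def)
    have F2: "ln (abs_prod \<eta> powr (2 * (real m - real k - 1) / (real m - real k)) / sq_sum \<eta> ^ (m - k - 1))
        = 2 * real (m - k - 1) * t - real (m - k - 1) * log_sum (u \<circ> Inr)"
      using f2(2) mk card by (simp add: sum_t o_def)
    have main: "ln_ext (P powr e / sq_sum z ^ 2
        * (abs_prod \<zeta> powr (2 * real k / (real k + 1)) / sq_sum \<zeta> ^ k)
        * (abs_prod \<eta> powr (2 * (real m - real k - 1) / (real m - real k)) / sq_sum \<eta> ^ (m - k - 1)))
      = ereal (4 * r + 2 * real k * s + 2 * real (m - k - 1) * t - ref_potential m k u)"
      if P: "0 < P" and r: "e * ln P = 4 * r" for P e r :: real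
    proof -
      have pos: "0 < P powr e / sq_sum z ^ 2" using P sq by simp
      have P_ln: "ln (P powr e / sq_sum z ^ 2) = 4 * r - 2 * log_sum u"
        using P sq r by (simp add: ln_div ln_powr ln_realpow)
      show ?thesis
        unfolding ln_ext_mult3[OF pos f1(1) f2(1)] P_ln F1 F2 by (simp add: ref_potential_def)
    qed
    have "psi1 m k z \<zeta> \<eta>
        = ereal (4 * s + 2 * real k * s + 2 * real (m - k - 1) * t - ref_potential m k u)"
      unfolding psi1_def by (rule main) (use pf in simp_all)
    moreover have "psi2 m k z \<zeta> \<eta>
        = ereal (4 * t + 2 * real k * s + 2 * real (m - k - 1) * t - ref_potential m k u)"
      unfolding psi2_def by (rule main) (use ps mk in simp_all)
    ultimately have "psi_hat m k z \<zeta> \<eta>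
        = ereal (4 * min s t + 2 * real k * s + 2 * real (m - k - 1) * t - ref_potential m k u)"
      by (auto simp: psi_hat_def inf_min min_def)
    then show ?thesis using bound by simp
  qed
qed

end
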